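(* Let $G$ be a (possibly infinite) graph with at least two vertices. The following are equivalent: (1) $G$ is $3$-sac; (2) $G$ is cyclically connected; (3) any three points of $|G|$ lie on a circle or a $\theta$-curve contained in $|G|$; (4) $G\neq K_2$ and $G$ is $2$-connected; (5) $G$ is $2$-cc.
   Context: A graph $G=(V,E)$ consists of a (possibly infinite) vertex set $V$ and a set $E\subseteq[V]^2$ of edges (vertex degrees may be infinite). $|G|$ denotes the $1$-complex of $G$: the quotient of $V\oplus\bigoplus_{e\in E}[0,1]_e$ ($V$ discrete) in which, for each edge $e=\{v,w\}$, the point $0\in[0,1]_e$ is identified with $v$ and $1\in[0,1]_e$ with $w$. An arc is a homeomorphic copy of $[0,1]$; a circle is a simple closed curve (homeomorphic copy of $S^1$). A $\theta$-curve is a space homeomorphic to the union of three arcs with the same two endpoints that are otherwise pairwise disjoint. $G$ is $n$-sac ($n$-strongly arc connected) if for any list of no more than $n$ distinct points of $|G|$ there is an arc in $|G|$ containing the points in the specified order. $G$ is $n$-cc if for any choice of at most $n$ points of $|G|$ there is a circle in $|G|$ containing them. $G$ is cyclically connected if every two vertices lie on a (graph-theoretic, finite) cycle of $G$. $G$ is $k$-connected if $G-W$ is connected for all $W\subseteq V$ with $|W|<k$ (so the complete graph $K_2$ on two vertices counts as $2$-connected). *)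

theory Defs
  imports "HOL-Analysis.Analysis"
begin

section \<open>Graphs\<close>

definition simple_graph :: "'a set \<Rightarrow> 'a set set \<Rightarrow> bool" where
  "simple_graph V E \<longleftrightarrow> E \<subseteq> {e. e \<subseteq> V \<and> card e = 2}"

definition complete_graph :: "nat \<Rightarrow> 'a set \<Rightarrow> 'a set set \<Rightarrow> bool" where
  "complete_graph n V E \<longleftrightarrow> finite V \<and> card V = n \<and> E = {e. e \<subseteq> V \<and> card e = 2}"

definition graph_path :: "'a set \<Rightarrow> 'a set set \<Rightarrow> 'a list \<Rightarrow> bool" where
  "graph_path V E p \<longleftrightarrow>
     p \<noteq> [] \<and> distinct p \<and> set p \<subseteq> V \<and> successively (\<lambda>x y. {x, y} \<in> E) p"

definition graph_cycle :: "'a set \<Rightarrow> 'a set set \<Rightarrow> 'a list \<Rightarrow> bool" where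
  "graph_cycle V E p \<longleftrightarrow> graph_path V E p \<and> 3 \<le> length p \<and> {last p, hd p} \<in> E"

definition connected_graph :: "'a set \<Rightarrow> 'a set set \<Rightarrow> bool" where
  "connected_graph V E \<longleftrightarrow>
     (\<forall>u\<in>V. \<forall>v\<in>V. \<exists>p. graph_path V E p \<and> hd p = u \<and> last p = v)"

text \<open>There is no lower bound on the number of vertices, so the complete graph on two
  vertices is 2-connected.\<close>

definition k_connected_graph :: "nat \<Rightarrow> 'a set \<Rightarrow> 'a set set \<Rightarrow> bool" where
  "k_connected_graph k V E \<longleftrightarrow>
     (\<forall>W \<subseteq> V. finite W \<and> card W < k \<longrightarrow> connected_graph (V - W) {e \<in> E. e \<inter> W = {}})"

definition cyclically_connected :: "'a set \<Rightarrow> 'a set set \<Rightarrow> bool" where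
  "cyclically_connected V E \<longleftrightarrow>
     (\<forall>u\<in>V. \<forall>v\<in>V. u \<noteq> v \<longrightarrow> (\<exists>p. graph_cycle V E p \<and> u \<in> set p \<and> v \<in> set p))"


section \<open>The 1-complex of a graph\<close>

text \<open>The space before gluing is the topological sum of a one-point space for every vertex
  (together the discrete space \<^term>\<open>V\<close>) and a unit interval for every edge.
  The vertex \<^term>\<open>v\<close> is the point \<^term>\<open>(Inl v, 0)\<close>, the point \<^term>\<open>t\<close> of the
  interval of the edge \<^term>\<open>e\<close> is \<^term>\<open>(Inr e, t)\<close>.\<close>

type_synonym 'a complex_point = "('a + 'a set) \<times> real"

definition pre_complex :: "'a set \<Rightarrow> 'a set set \<Rightarrow> 'a complex_point topology" where
  "pre_complex V E =
     sum_topology (case_sum (\<lambda>v. top_of_set {0}) (\<lambda>e. top_of_set {0..1})) (V <+> E)"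

text \<open>An arbitrary orientation of the edges decides which end is glued to \<^term>\<open>0\<close> and which
  to \<^term>\<open>1\<close>.\<close>

definition tail_of :: "'a set \<Rightarrow> 'a" where
  "tail_of e = (SOME v. v \<in> e)"

definition head_of :: "'a set \<Rightarrow> 'a" where
  "head_of e = (SOME w. w \<in> e - {tail_of e})"

text \<open>Each class of glued points is represented by its vertex if it has one, and
  is a single interior point of an edge otherwise.\<close>

fun glue :: "'a complex_point \<Rightarrow> 'a complex_point" where
  "glue (Inl v, t) = (Inl v, t)"
| "glue (Inr e, t) =
     (if t = 0 then (Inl (tail_of e), 0) else if t = 1 then (Inl (head_of e), 0) else (Inr e, t))"

definition quotient_topology :: "'b topology \<Rightarrow> ('b \<Rightarrow> 'c) \<Rightarrow> 'c topology" where
  "quotient_topology X q =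
     topology (\<lambda>U. U \<subseteq> q ` topspace X \<and> openin X {x \<in> topspace X. q x \<in> U})"

definition one_complex :: "'a set \<Rightarrow> 'a set set \<Rightarrow> 'a complex_point topology" where
  "one_complex V E = quotient_topology (pre_complex V E) glue"

lemma openin_quotient_topology:
  "openin (quotient_topology X q) U \<longleftrightarrow>
     U \<subseteq> q ` topspace X \<and> openin X {x \<in> topspace X. q x \<in> U}"
proof -
  have "istopology (\<lambda>U. U \<subseteq> q ` topspace X \<and> openin X {x \<in> topspace X. q x \<in> U})"
    unfolding istopology_def
  proof (intro conjI allI impI)
    fix S T
    assume "S \<subseteq> q ` topspace X \<and> openin X {x \<in> topspace X. q x \<in> S}"
      and "T \<subseteq> q ` topspace X \<and> openin X {x \<in> topspace X. q x \<in> T}"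
    moreover have "{x \<in> topspace X. q x \<in> S \<inter> T} =
        {x \<in> topspace X. q x \<in> S} \<inter> {x \<in> topspace X. q x \<in> T}" by auto
    ultimately show "S \<inter> T \<subseteq> q ` topspace X" "openin X {x \<in> topspace X. q x \<in> S \<inter> T}"
      by auto
  next
    fix K
    assume K: "\<forall>S\<in>K. S \<subseteq> q ` topspace X \<and> openin X {x \<in> topspace X. q x \<in> S}"
    then show "\<Union>K \<subseteq> q ` topspace X" by auto
    have "{x \<in> topspace X. q x \<in> \<Union>K} = (\<Union>S\<in>K. {x \<in> topspace X. q x \<in> S})" by auto
    then show "openin X {x \<in> topspace X. q x \<in> \<Union>K}" using K by auto
  qed
  then show ?thesis by (simp add: quotient_topology_def)
qed

lemma topspace_quotient_topology [simp]: "topspace (quotient_topology X q) = q ` topspace X"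
proof (rule subset_antisym)
  show "topspace (quotient_topology X q) \<subseteq> q ` topspace X"
    by (rule openin_quotient_topology[THEN iffD1, OF openin_topspace, THEN conjunct1])
  have "{x \<in> topspace X. q x \<in> q ` topspace X} = topspace X" by auto
  then have "openin (quotient_topology X q) (q ` topspace X)"
    by (simp add: openin_quotient_topology)
  then show "q ` topspace X \<subseteq> topspace (quotient_topology X q)" by (rule openin_subset)
qed

lemma quotient_map_quotient_topology: "quotient_map X (quotient_topology X q) q"
  unfolding quotient_map_def by (auto simp: openin_quotient_topology)

lemma quotient_map_glue: "quotient_map (pre_complex V E) (one_complex V E) glue"
  by (simp add: one_complex_def quotient_map_quotient_topology)

lemma edge_eq_tail_head:
  assumes "card e = 2"
  shows "e = {tail_of e, head_of e}" "tail_of e \<noteq> head_of e"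
proof -
  obtain x y where e: "e = {x, y}" "x \<noteq> y" using assms by (auto simp: card_2_iff)
  have t: "tail_of e \<in> e" unfolding tail_of_def by (rule someI[of _ x]) (simp add: e)
  then have "\<exists>w. w \<in> e - {tail_of e}" using e by auto
  then have h: "head_of e \<in> e - {tail_of e}" unfolding head_of_def by (rule someI_ex)
  show "e = {tail_of e, head_of e}" "tail_of e \<noteq> head_of e" using t h e by auto
qed

text \<open>The fibres of \<^term>\<open>glue\<close> are the classes of the equivalence relation generated by
  gluing the two ends of every interval to the two ends of the edge.\<close>

inductive glued_end :: "'a set set \<Rightarrow> 'a complex_point \<Rightarrow> 'a complex_point \<Rightarrow> bool" for E where
  "e \<in> E \<Longrightarrow> glued_end E (Inr e, 0) (Inl (tail_of e), 0)"
| "e \<in> E \<Longrightarrow> glued_end E (Inr e, 1) (Inl (head_of e), 0)"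

lemma glue_eq_iff:
  assumes "x \<in> topspace (pre_complex V E)" "y \<in> topspace (pre_complex V E)"
  shows "glue x = glue y \<longleftrightarrow> equivclp (glued_end E) x y"
proof
  have *: "equivclp (glued_end E) z (glue z)" if "z \<in> topspace (pre_complex V E)" for z
    using that r_into_equivclp[of "glued_end E", OF glued_end.intros(1)]
      r_into_equivclp[of "glued_end E", OF glued_end.intros(2)]
    by (cases z rule: glue.cases) (auto simp: pre_complex_def)
  assume "glue x = glue y"
  then show "equivclp (glued_end E) x y"
    using *[OF assms(1)] *[OF assms(2)] by (metis equivclp_sym equivclp_trans)
next
  assume "equivclp (glued_end E) x y"
  then show "glue x = glue y"
    by (induction rule: equivclp_induct) (auto elim!: glued_end.cases)
qed


section \<open>Arcs, circles and theta curves\<close>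

definition arc_map :: "'b topology \<Rightarrow> (real \<Rightarrow> 'b) \<Rightarrow> bool" where
  "arc_map X f \<longleftrightarrow> embedding_map (top_of_set {0..1}) X f"

definition arc_between :: "'b topology \<Rightarrow> 'b set \<Rightarrow> 'b \<Rightarrow> 'b \<Rightarrow> bool" where
  "arc_between X A a b \<longleftrightarrow> (\<exists>f. arc_map X f \<and> f ` {0..1} = A \<and> f 0 = a \<and> f 1 = b)"

definition circle_in :: "'b topology \<Rightarrow> 'b set \<Rightarrow> bool" where
  "circle_in X C \<longleftrightarrow>
     C \<subseteq> topspace X \<and> subtopology X C homeomorphic_space top_of_set (sphere (0::complex) 1)"

definition theta_space :: "'b topology \<Rightarrow> bool" where
  "theta_space Y \<longleftrightarrow>
     (\<exists>a b A1 A2 A3. arc_between Y A1 a b \<and> arc_between Y A2 a b \<and> arc_between Y A3 a b \<and>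
        A1 \<inter> A2 = {a, b} \<and> A1 \<inter> A3 = {a, b} \<and> A2 \<inter> A3 = {a, b} \<and>
        topspace Y = A1 \<union> A2 \<union> A3)"

definition theta_curve_in :: "'b topology \<Rightarrow> 'b set \<Rightarrow> bool" where
  "theta_curve_in X T \<longleftrightarrow> T \<subseteq> topspace X \<and> theta_space (subtopology X T)"

lemma arc_between_homeomorphic_image:
  fixes Y :: "'b topology"
  assumes "homeomorphic_map Y Z h" "arc_between Y A a b"
  shows "arc_between Z (h ` A) (h a) (h b)"
proof -
  obtain f :: "real \<Rightarrow> 'b" where
    f: "embedding_map (top_of_set {0..1}) Y f" "f ` {0..1} = A" "f 0 = a" "f 1 = b"
    using assms(2) unfolding arc_between_def arc_map_def by (elim exE conjE) (rule that)
  have "embedding_map (top_of_set {0..1}) Z (h \<circ> f)"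
    by (rule embedding_map_compose[OF f(1) surjective_embedding_map[THEN iffD2, THEN conjunct1, OF assms(1)]])
  moreover have "(h \<circ> f) ` {0..1} = h ` A" "(h \<circ> f) 0 = h a" "(h \<circ> f) 1 = h b"
    using f(2-) by (simp_all only: image_comp[symmetric] o_apply)
  ultimately show ?thesis
    unfolding arc_between_def arc_map_def by (intro exI[of _ "h \<circ> f"] conjI)
qed

text \<open>Being a union of three such arcs is a topological property, so every homeomorphic copy
  of such a union is covered.\<close>

lemma theta_space_homeomorphic:
  assumes "Y homeomorphic_space Z" "theta_space Y"
  shows "theta_space Z"
proof -
  obtain h where h: "homeomorphic_map Y Z h"
    using assms(1) by (auto simp: homeomorphic_space)
  obtain a b A1 A2 A3 where A: "arc_between Y A1 a b" "arc_between Y A2 a b" "arc_between Y A3 a b"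
    "A1 \<inter> A2 = {a, b}" "A1 \<inter> A3 = {a, b}" "A2 \<inter> A3 = {a, b}" "topspace Y = A1 \<union> A2 \<union> A3"
    using assms(2) unfolding theta_space_def by blast
  have inj: "inj_on h (topspace Y)" and surj: "h ` topspace Y = topspace Z"
    using h by (auto simp: homeomorphic_imp_injective_map homeomorphic_imp_surjective_map)
  have int: "h ` B \<inter> h ` C = {h a, h b}"
    if "B \<inter> C = {a, b}" "B \<subseteq> topspace Y" "C \<subseteq> topspace Y" for B C
    using inj_on_image_Int[OF inj that(2,3)] that(1) by simp
  have sub: "A1 \<subseteq> topspace Y" "A2 \<subseteq> topspace Y" "A3 \<subseteq> topspace Y"
    using A(7) by auto
  have "topspace Z = h ` A1 \<union> h ` A2 \<union> h ` A3"
    unfolding surj[symmetric] A(7) image_Un ..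
  then show ?thesis
    unfolding theta_space_def
    using arc_between_homeomorphic_image[OF h A(1)] arc_between_homeomorphic_image[OF h A(2)]
      arc_between_homeomorphic_image[OF h A(3)] int[OF A(4) sub(1,2)] int[OF A(5) sub(1,3)]
      int[OF A(6) sub(2,3)]
    by blast
qed

definition n_sac :: "nat \<Rightarrow> 'b topology \<Rightarrow> bool" where
  "n_sac n X \<longleftrightarrow>
     (\<forall>xs. set xs \<subseteq> topspace X \<and> distinct xs \<and> length xs \<le> n \<longrightarrow>
        (\<exists>f ts. arc_map X f \<and> set ts \<subseteq> {0..1} \<and> sorted_wrt (<) ts \<and> map f ts = xs))"

definition n_cc :: "nat \<Rightarrow> 'b topology \<Rightarrow> bool" where
  "n_cc n X \<longleftrightarrow>
     (\<forall>S. S \<subseteq> topspace X \<and> finite S \<and> card S \<le> n \<longrightarrow> (\<exists>C. circle_in X C \<and> S \<subseteq> C))"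

text \<open>The three points need not be distinct: otherwise the property would hold vacuously for
  the graph with two vertices and no edge.\<close>

definition three_points_on_circle_or_theta :: "'b topology \<Rightarrow> bool" where
  "three_points_on_circle_or_theta X \<longleftrightarrow>
     (\<forall>x \<in> topspace X. \<forall>y \<in> topspace X. \<forall>z \<in> topspace X.
        \<exists>C. (circle_in X C \<or> theta_curve_in X C) \<and> {x, y, z} \<subseteq> C)"

end

(* The topological part takes place in an arbitrary Hausdorff space.  If any two points lie on a
   circle, then three points x, y, z lie on an arc in this order: follow a circle through y and z
   from z in both directions until it first meets a circle K through x and y; one of the two
   hitting points is not x, and an arc of K from x through y to it can be continued to z.  If y is
   not on a circle through x and z, cutting the arc through x, y, z where it leaves and re-enters
   that circle around y gives a theta curve.  Conversely each of the three topological conditions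
   implies that any two points are joined by a connected set avoiding a given third point.
   A function on the vertices extends linearly to a continuous real function on |G|, so a cut
   vertex, a disconnection, or G = K_2 contradicts the intermediate value theorem.

   The graph part is Whitney's argument: in a 2-connected graph other than K_2 any two edges lie on
   a common cycle, so any two points of |G| lie on a circle. *)
theory Submission
  imports Defs
begin

section \<open>Arcs in Hausdorff spaces\<close>

text \<open>The quotient topology is used only through the continuity of \<open>glue\<close> and its
  universal property: continuity of a map out of |G| is tested on each closed edge. Real functions
  built this way give both the Hausdorff property and the obstructions to connectedness, and no arc
  or circle of |G| ever has to be decomposed into vertices and edges.

  Being Hausdorff enters twice: it turns continuous injections of [0,1] or of the unit circle into
  embeddings, and it makes circles closed, so that an arc running into a circle has a first point on
  it.

  Condition (5) is the hub: (4) gives (5) by realising graph cycles as circles, (5) gives (1) and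
  (3), and each of (1), (3), (5) leads back to (4). Conditions (2) and (4) are compared inside the
  graph. The consequence that leads back to (4) deliberately forgets arcs and keeps connected sets,
  which is all that the intermediate value theorem uses.\<close>

lemma arc_mapI:
  assumes "Hausdorff_space X" "continuous_map (top_of_set {0..1}) X f" "inj_on f {0..1}"
  shows "arc_map X f"
  unfolding arc_map_def using assms
  by (intro continuous_imp_embedding_map) (auto simp: compact_space_subtopology compactin_euclidean_iff)

lemma arc_map_continuous: "arc_map X f \<Longrightarrow> continuous_map (top_of_set {0..1}) X f"
  unfolding arc_map_def embedding_map_def
  using homeomorphic_imp_continuous_map continuous_map_into_fulltopology by blast

lemma arc_map_inj: "arc_map X f \<Longrightarrow> inj_on f {0..1}"
  unfolding arc_map_def embedding_map_def
  using homeomorphic_imp_injective_map by force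

text \<open>Rescaling, reversal and the two halves of a concatenation are all affine
  reparametrisations. The rigid form \<open>d * x + c\<close> matches
  \<open>image_affinity_atLeastAtMost\<close>, hence spellings such as \<open>2 * x + 0\<close> and
  \<open>(-1) * x + 1\<close> below.\<close>

lemma continuous_map_affine_reparam:
  fixes s t :: real
  assumes "continuous_map (top_of_set {s..t}) X f" "(\<lambda>x. d * x + c) ` T \<subseteq> {s..t}"
  shows "continuous_map (top_of_set T) X (\<lambda>x. f (d * x + c))"
proof -
  have "continuous_map (top_of_set T) (top_of_set {s..t}) (\<lambda>x. d * x + c)"
    unfolding continuous_map_subtopology_eu using assms(2)
    by (intro conjI continuous_intros) auto
  from continuous_map_compose[OF this assms(1)] show ?thesis by (simp add: o_def)
qed

lemma arc_betweenI_interval: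
  fixes s t :: real
  assumes X: "Hausdorff_space X" and st: "s < t"
    and cont: "continuous_map (top_of_set {s..t}) X f" and inj: "inj_on f {s..t}"
  shows "arc_between X (f ` {s..t}) (f s) (f t)"
proof -
  let ?a = "\<lambda>x::real. (t - s) * x + s"
  have im: "?a ` {0..1} = {s..t}"
    using st by (simp add: image_affinity_atLeastAtMost)
  have "inj_on (f \<circ> ?a) {0..1}"
    using st inj by (intro comp_inj_on) (auto simp: im inj_on_def)
  moreover have "continuous_map (top_of_set {0..1}) X (\<lambda>x. f (?a x))"
    by (rule continuous_map_affine_reparam[OF cont]) (simp add: im)
  ultimately have "arc_map X (\<lambda>x. f (?a x))"
    using X by (intro arc_mapI) (auto simp: o_def)
  moreover have "(\<lambda>x. f (?a x)) ` {0..1} = f ` {s..t}"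
    using image_image[of f ?a "{0..1}"] im by simp
  ultimately show ?thesis
    unfolding arc_between_def by (intro exI[of _ "\<lambda>x. f (?a x)"]) auto
qed

lemma arc_map_imp_arc_between:
  assumes "Hausdorff_space X" "arc_map X f" "0 \<le> s" "s < t" "t \<le> 1"
  shows "arc_between X (f ` {s..t}) (f s) (f t)"
proof (rule arc_betweenI_interval[OF assms(1,4)])
  have "{s..t} \<subseteq> {0..1}" using assms(3-5) by auto
  then show "continuous_map (top_of_set {s..t}) X f" "inj_on f {s..t}"
    using continuous_map_from_subtopology_mono[OF arc_map_continuous[OF assms(2)]]
      inj_on_subset[OF arc_map_inj[OF assms(2)]] by blast+
qed

lemma arc_between_sym:
  assumes "Hausdorff_space X" "arc_between X A a b"
  shows "arc_between X A b a"
proof -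
  obtain f where f: "arc_map X f" "f ` {0..1} = A" "f 0 = a" "f 1 = b"
    using assms(2) unfolding arc_between_def by (elim exE conjE) (rule that)
  have im: "(\<lambda>x::real. (-1) * x + 1) ` {0..1} = {0..1}"
    by (subst image_affinity_atLeastAtMost) simp
  have "continuous_map (top_of_set {0..1}) X (\<lambda>x. f ((-1) * x + 1))"
    by (rule continuous_map_affine_reparam[OF arc_map_continuous[OF f(1)]]) (simp only: im order_refl)
  moreover have "inj_on (\<lambda>x. f ((-1) * x + 1)) {0..1}"
    by (rule inj_onI) (use inj_onD[OF arc_map_inj[OF f(1)]] in force)
  ultimately have "arc_map X (\<lambda>x. f ((-1) * x + 1))"
    using assms(1) by (intro arc_mapI)
  moreover have "(\<lambda>x. f ((-1) * x + 1)) ` {0..1} = A"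
    using image_image[of f "\<lambda>x. (-1) * x + 1" "{0..1}"] im f(2) by simp
  ultimately show ?thesis
    using f unfolding arc_between_def by (intro exI[of _ "\<lambda>x. f ((-1) * x + 1)"]) auto
qed

lemma arc_between_ends:
  assumes "arc_between X A a b"
  shows "a \<in> A" "b \<in> A" "a \<noteq> b" "A \<subseteq> topspace X"
proof -
  obtain f where f: "arc_map X f" "f ` {0..1} = A" "f 0 = a" "f 1 = b"
    using assms unfolding arc_between_def by (elim exE conjE) (rule that)
  show "a \<in> A" "b \<in> A" using f by (auto simp flip: f(2))
  show "a \<noteq> b" using inj_onD[OF arc_map_inj[OF f(1)], of 0 1] f(3,4) by auto
  show "A \<subseteq> topspace X"
    using continuous_map_image_subset_topspace[OF arc_map_continuous[OF f(1)]] f(2) by simp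
qed

lemma arc_between_connectedin:
  assumes "arc_between X A a b"
  shows "connectedin X A"
proof -
  obtain f where f: "arc_map X f" "f ` {0..1} = A"
    using assms unfolding arc_between_def by blast
  have "connectedin X (f ` {0..1})"
    by (rule connectedin_continuous_map_image[OF arc_map_continuous[OF f(1)]])
      (simp add: connectedin_subtopology)
  then show ?thesis using f(2) by simp
qed

text \<open>The common end sits at the known parameter 1/2, so that an arc through three points in a
  given order can be exhibited with explicit parameters.\<close>

lemma arc_between_concat:
  assumes X: "Hausdorff_space X" and A: "arc_between X A a b" and B: "arc_between X B b c"
    and AB: "A \<inter> B = {b}"
  obtains h where "arc_map X h" "h ` {0..1} = A \<union> B" "h 0 = a" "h (1/2) = b" "h 1 = c"
proof -
  obtain f where f: "arc_map X f" "f ` {0..1} = A" "f 0 = a" "f 1 = b"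
    using A unfolding arc_between_def by (elim exE conjE) (rule that)
  obtain g where g: "arc_map X g" "g ` {0..1} = B" "g 0 = b" "g 1 = c"
    using B unfolding arc_between_def by (elim exE conjE) (rule that)
  define h where "h = (\<lambda>x::real. if x \<le> 1/2 then f (2 * x + 0) else g (2 * x + -1))"
  have im1: "(\<lambda>x::real. 2 * x + 0) ` {0..1/2} = {0..1}"
    by (subst image_affinity_atLeastAtMost) simp
  have im2: "(\<lambda>x::real. 2 * x + -1) ` {1/2..1} = {0..1}"
    by (subst image_affinity_atLeastAtMost) simp
  have cf: "continuous_map (top_of_set {0..1/2}) X (\<lambda>x. f (2 * x + 0))"
    by (rule continuous_map_affine_reparam[OF arc_map_continuous[OF f(1)]]) auto
  have cg: "continuous_map (top_of_set {1/2..1}) X (\<lambda>x. g (2 * x + -1))"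
    by (rule continuous_map_affine_reparam[OF arc_map_continuous[OF g(1)]]) auto
  have s1: "{0..1} \<inter> {x \<in> {0..1}. x \<le> 1/2} = {0..1/2::real}"
    and s2: "{0..1} \<inter> {x \<in> {0..1}. 1/2 \<le> x} = {1/2..1::real}" by auto
  have ch: "continuous_map (top_of_set {0..1}) X h"
    unfolding h_def
  proof (rule continuous_map_cases_le)
    show "continuous_map (subtopology (top_of_set {0..1}) {x \<in> topspace (top_of_set {0..1}). x \<le> 1/2})
        X (\<lambda>x. f (2 * x + 0))"
      unfolding subtopology_subtopology topspace_euclidean_subtopology s1 by (rule cf)
    show "continuous_map (subtopology (top_of_set {0..1}) {x \<in> topspace (top_of_set {0..1}). 1/2 \<le> x})
        X (\<lambda>x. g (2 * x + -1))"
      unfolding subtopology_subtopology topspace_euclidean_subtopology s2 by (rule cg)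
    show "f (2 * x + 0) = g (2 * x + -1)" if "x = 1/2" for x
      unfolding that using f(4) g(3) by simp
  qed (auto intro: continuous_intros)
  have gh: "g (2 * x + -1) = h x" if "x \<in> {1/2..1}" for x
  proof (cases "x = 1/2")
    case True
    show ?thesis unfolding True using f(4) g(3) by (simp add: h_def)
  qed (use that in \<open>auto simp: h_def\<close>)
  have hA: "h ` {0..1/2} = A"
  proof -
    have "h ` {0..1/2} = (\<lambda>x. f (2 * x + 0)) ` {0..1/2}" by (auto simp: h_def)
    then show ?thesis using image_image[of f "\<lambda>x. 2 * x + 0" "{0..1/2}"] im1 f(2) by simp
  qed
  have hB: "h ` {1/2..1} = B"
  proof -
    have "h ` {1/2..1} = (\<lambda>x. g (2 * x + -1)) ` {1/2..1}"
      using gh by (intro image_cong) auto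
    then show ?thesis using image_image[of g "\<lambda>x. 2 * x + -1" "{1/2..1}"] im2 g(2) by simp
  qed
  have "{0..1::real} = {0..1/2} \<union> {1/2..1}" by auto
  then have im: "h ` {0..1} = A \<union> B" using hA hB by (simp add: image_Un)
  have inj1: "x = y" if "x \<in> {0..1/2}" "y \<in> {0..1/2}" "h x = h y" for x y
    using that inj_onD[OF arc_map_inj[OF f(1)], of "2 * x + 0" "2 * y + 0"]
    by (auto simp: h_def)
  have inj2: "x = y" if "x \<in> {1/2..1}" "y \<in> {1/2..1}" "h x = h y" for x y
  proof -
    have "g (2 * x + -1) = g (2 * y + -1)" using that gh by simp
    then show ?thesis
      using that inj_onD[OF arc_map_inj[OF g(1)], of "2 * x + -1" "2 * y + -1"] by auto
  qed
  have half: "h (1/2) = b" using f(4) by (simp add: h_def)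
  have inj3: "x = y" if "x \<in> {0..1/2}" "y \<in> {1/2..1}" "h x = h y" for x y
  proof -
    have "h x \<in> A" using that(1) unfolding hA[symmetric] by (rule imageI)
    moreover have "h x \<in> B" using that(2) unfolding hB[symmetric] that(3) by (rule imageI)
    ultimately have "h x = b" using AB by blast
    then have "x = 1/2" "y = 1/2"
      using inj1[of x "1/2"] inj2[of y "1/2"] that half by auto
    then show ?thesis by simp
  qed
  have "inj_on h {0..1}"
  proof (rule inj_onI)
    fix x y :: real assume "x \<in> {0..1}" "y \<in> {0..1}" "h x = h y"
    then show "x = y"
      using inj1[of x y] inj2[of x y] inj3[of x y] inj3[of y x]
      by (cases "x \<le> 1/2"; cases "y \<le> 1/2") auto
  qed
  with X ch have "arc_map X h" by (rule arc_mapI)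
  then show thesis using that[of h] im half f(3) g(4) by (auto simp: h_def)
qed

lemma arc_between_join:
  assumes "Hausdorff_space X" "arc_between X A a b" "arc_between X B b c" "A \<inter> B = {b}"
  shows "arc_between X (A \<union> B) a c"
  using arc_between_concat[OF assms] unfolding arc_between_def by metis

lemma arc_between_split:
  assumes X: "Hausdorff_space X" and A: "arc_between X A a b" and u: "u \<in> A" "u \<noteq> a" "u \<noteq> b"
  obtains B C where "arc_between X B a u" "arc_between X C u b" "B \<union> C = A" "B \<inter> C = {u}"
proof -
  obtain f where f: "arc_map X f" "f ` {0..1} = A" "f 0 = a" "f 1 = b"
    using A unfolding arc_between_def by (elim exE conjE) (rule that)
  obtain t where t: "t \<in> {0..1}" "f t = u" using u(1) f(2) by blast
  then have t': "0 < t" "t < 1" using u f(3,4) by (auto simp: less_le)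
  show thesis
  proof
    show "arc_between X (f ` {0..t}) a u"
      using arc_map_imp_arc_between[OF X f(1), of 0 t] t t' f by simp
    show "arc_between X (f ` {t..1}) u b"
      using arc_map_imp_arc_between[OF X f(1), of t 1] t t' f by simp
    have "{0..t} \<union> {t..1} = {0..1}" using t by auto
    then show "f ` {0..t} \<union> f ` {t..1} = A" using f(2) by (simp flip: image_Un)
    have "f ` {0..t} \<inter> f ` {t..1} = f ` ({0..t} \<inter> {t..1})"
      using t' by (intro inj_on_image_Int[OF arc_map_inj[OF f(1)], symmetric]) auto
    moreover have "{0..t} \<inter> {t..1} = {t}" using t by auto
    ultimately show "f ` {0..t} \<inter> f ` {t..1} = {u}" using t by simp
  qed
qed

text \<open>The parameters that land in K form a closed set, so its infimum is attained; it is
  positive because a lies outside K. Stopping there leaves the end as the only point on K.\<close>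

lemma arc_between_first_hit:
  assumes X: "Hausdorff_space X" and A: "arc_between X A a b"
    and K: "closedin X K" "a \<notin> K" "b \<in> K"
  obtains c A' where "arc_between X A' a c" "A' \<subseteq> A" "A' \<inter> K = {c}"
proof -
  obtain f where f: "arc_map X f" "f ` {0..1} = A" "f 0 = a" "f 1 = b"
    using A unfolding arc_between_def by (elim exE conjE) (rule that)
  define T where "T = {t \<in> {0..1}. f t \<in> K}"
  have "closedin (top_of_set {0..1}) T"
    using closedin_continuous_map_preimage[OF arc_map_continuous[OF f(1)] K(1)]
    by (simp add: T_def)
  then have "closed T" by (simp add: closedin_closed_eq)
  moreover have "1 \<in> T" using f K by (simp add: T_def)
  moreover have bdd: "bdd_below T" by (auto simp: T_def bdd_below_def)
  ultimately have t: "Inf T \<in> T" by (intro closed_contains_Inf) auto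
  define t where "t = Inf T"
  have t01: "t \<in> {0..1}" "f t \<in> K" using t by (auto simp: T_def t_def)
  moreover have "t \<noteq> 0" using t01 f K by metis
  ultimately have t0: "0 < t" by auto
  show thesis
  proof
    show "arc_between X (f ` {0..t}) a (f t)"
      using arc_map_imp_arc_between[OF X f(1), of 0 t] t0 t01 f by simp
    show "f ` {0..t} \<subseteq> A" using f t01 by auto
    have "s \<notin> T" if "s < t" for s using that cInf_lower[OF _ bdd, of s] by (auto simp: t_def)
    then have "s = t" if "s \<in> {0..t}" "f s \<in> K" for s
      using that t01 unfolding T_def by force
    then show "f ` {0..t} \<inter> K = {f t}" using t01 t0 by force
  qed
qed


section \<open>Circles and pairs of arcs\<close>

lemma circle_in_two_arcs:
  assumes X: "Hausdorff_space X" and A: "arc_between X A a b" and B: "arc_between X B a b"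
    and AB: "A \<inter> B = {a, b}"
  shows "circle_in X (A \<union> B)"
proof -
  obtain f where f: "arc_map X f" "f ` {0..1} = A" "f 0 = a" "f 1 = b"
    using A unfolding arc_between_def by (elim exE conjE) (rule that)
  obtain g where g: "arc_map X g" "g ` {0..1} = B" "g 0 = a" "g 1 = b"
    using B unfolding arc_between_def by (elim exE conjE) (rule that)
  define S where "S = sphere (0::complex) 1"
  \<comment> \<open>Projection to the real axis, rescaled so that 1 goes to 0 and -1 goes to 1. The
    upper half circle then follows A and the lower one B, both from a to b, and they agree at the
    two real points.\<close>
  define p where "p = (\<lambda>z. - (1/2) * Re z + 1/2)"
  define h where "h = (\<lambda>z. if 0 \<le> Im z then f (p z) else g (p z))"
  have S_eq: "z \<in> S \<longleftrightarrow> (Re z)\<^sup>2 + (Im z)\<^sup>2 = 1" for z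
    by (simp add: S_def cmod_def)
  have p01: "p z \<in> {0..1}" if "z \<in> S" for z
    using that abs_Re_le_cmod[of z] by (auto simp: p_def S_def)
  have real: "p z = 0 \<or> p z = 1" if "z \<in> S" "Im z = 0" for z
    using that by (auto simp: S_eq p_def power2_eq_1_iff)
  have fg: "f (p z) = g (p z)" if "z \<in> S" "Im z = 0" for z
    using real[OF that] f g by auto
  have cp: "continuous_map (top_of_set T) (top_of_set {0..1}) p" if "T \<subseteq> S" for T
    unfolding continuous_map_subtopology_eu using that p01
    by (auto simp: p_def intro!: continuous_intros)
  have cf: "continuous_map (top_of_set T) X (\<lambda>z. f (p z))"
    and cg: "continuous_map (top_of_set T) X (\<lambda>z. g (p z))" if "T \<subseteq> S" for T
    using continuous_map_compose[OF cp[OF that] arc_map_continuous[OF f(1)]]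
      continuous_map_compose[OF cp[OF that] arc_map_continuous[OF g(1)]] by (simp_all add: o_def)
  have ch: "continuous_map (top_of_set S) X h"
    unfolding h_def
  proof (rule continuous_map_cases_le)
    show "continuous_map (subtopology (top_of_set S) {z \<in> topspace (top_of_set S). 0 \<le> Im z}) X (\<lambda>z. f (p z))"
      "continuous_map (subtopology (top_of_set S) {z \<in> topspace (top_of_set S). Im z \<le> 0}) X (\<lambda>z. g (p z))"
      unfolding subtopology_subtopology by (rule cf cg; auto)+
    show "f (p z) = g (p z)" if "z \<in> topspace (top_of_set S)" "0 = Im z" for z
      using that fg by simp
  qed (auto intro: continuous_intros)
  \<comment> \<open>The sign s selects the half circle: over t lies the point with real part 1 - 2t
    and imaginary part s times the nonnegative root.\<close>
  have lift: "\<exists>z\<in>S. p z = t \<and> 0 \<le> s * Im z" if "t \<in> {0..1}" "s = 1 \<or> s = -1" for t s :: real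
  proof -
    have "\<bar>1 - 2 * t\<bar> \<le> 1" using that by (auto simp: abs_le_iff)
    then have "(1 - 2 * t)\<^sup>2 \<le> 1" using abs_le_square_iff[of "1 - 2 * t" 1] by simp
    then show ?thesis
      using that(2) by (intro bexI[of _ "Complex (1 - 2 * t) (s * sqrt (1 - (1 - 2 * t)\<^sup>2))"])
        (auto simp: S_eq p_def power_mult_distrib field_simps)
  qed
  have "h ` S = A \<union> B"
  proof
    show "h ` S \<subseteq> A \<union> B"
      unfolding f(2)[symmetric] g(2)[symmetric] h_def using p01 by auto
    show "A \<union> B \<subseteq> h ` S"
    proof (rule Un_least; rule subsetI)
      fix x assume "x \<in> A"
      then obtain t where t: "t \<in> {0..1}" "f t = x" using f(2) by blast
      then show "x \<in> h ` S" using lift[of t 1] by (force simp: h_def)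
    next
      fix x assume "x \<in> B"
      then obtain t where t: "t \<in> {0..1}" "g t = x" using g(2) by blast
      then obtain z where z: "z \<in> S" "p z = t" "Im z \<le> 0" using lift[of t "-1"] by auto
      then have "h z = x" using t fg[of z] by (auto simp: h_def)
      then show "x \<in> h ` S" using z by blast
    qed
  qed
  moreover have "inj_on h S"
  proof (rule inj_onI)
    fix w z assume wz: "w \<in> S" "z \<in> S" "h w = h z"
    have ends: "f t \<in> {a, b} \<longleftrightarrow> t \<in> {0, 1}" "g t \<in> {a, b} \<longleftrightarrow> t \<in> {0, 1}" if "t \<in> {0..1}" for t
      using that inj_onD[OF arc_map_inj[OF f(1)], of t 0] inj_onD[OF arc_map_inj[OF f(1)], of t 1]
        inj_onD[OF arc_map_inj[OF g(1)], of t 0] inj_onD[OF arc_map_inj[OF g(1)], of t 1] f g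
      by auto
    have fi: "f s = f t \<Longrightarrow> s = t" "g s = g t \<Longrightarrow> s = t" if "s \<in> {0..1}" "t \<in> {0..1}" for s t
      using that inj_onD[OF arc_map_inj[OF f(1)], of s t] inj_onD[OF arc_map_inj[OF g(1)], of s t] by auto
    have mixed: "f s = g t \<Longrightarrow> s = t \<and> t \<in> {0, 1}" if "s \<in> {0..1}" "t \<in> {0..1}" for s t
    proof -
      assume st: "f s = g t"
      then have "f s \<in> {a, b}" using that AB f(2) g(2) by (metis IntI imageI)
      then have "s \<in> {0, 1}" "t \<in> {0, 1}" using ends that st by auto
      then show "s = t \<and> t \<in> {0, 1}"
        using st f g arc_between_ends(3)[OF A] by auto
    qed
    note p = p01[OF wz(1)] p01[OF wz(2)]
    have "p w = p z \<and> ((0 \<le> Im w \<longleftrightarrow> 0 \<le> Im z) \<or> p z \<in> {0, 1})"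
    proof (cases "0 \<le> Im w \<longleftrightarrow> 0 \<le> Im z")
      case True
      then show ?thesis using wz(3) fi[OF p] by (cases "0 \<le> Im w") (simp_all add: h_def)
    next
      case False
      then have "f (p w) = g (p z) \<or> f (p z) = g (p w)"
        using wz(3) by (cases "0 \<le> Im w") (simp_all add: h_def)
      then show ?thesis using mixed[OF p] mixed[OF p(2,1)] by metis
    qed
    \<comment> \<open>Equal real parts leave only the sign of the imaginary part open. It is settled
      by lying on the same half circle, or the points are 1 or -1, where the imaginary part
      vanishes.\<close>
    then have re: "Re w = Re z" and im: "(0 \<le> Im w \<longleftrightarrow> 0 \<le> Im z) \<or> Re z = 1 \<or> Re z = -1"
      by (auto simp: p_def)
    then have "(Im w)\<^sup>2 = (Im z)\<^sup>2" using wz(1,2) by (simp add: S_eq)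
    then have "Im w = Im z"
      using im wz(2) by (auto simp: power2_eq_iff S_eq)
    with re show "w = z" by (simp add: complex_eq_iff)
  qed
  ultimately have "embedding_map (top_of_set S) X h" "h ` S = A \<union> B"
    using continuous_imp_embedding_map[OF ch _ X]
    by (auto simp: S_def compact_space_subtopology compactin_euclidean_iff)
  then have "top_of_set S homeomorphic_space subtopology X (A \<union> B)"
    using embedding_map_imp_homeomorphic_space[of "top_of_set S" X h] by simp
  then have "subtopology X (A \<union> B) homeomorphic_space top_of_set S"
    by (rule homeomorphic_space_sym[THEN iffD1])
  then show ?thesis
    using arc_between_ends(4)[OF A] arc_between_ends(4)[OF B]
    unfolding circle_in_def S_def by blast
qed

lemma cis_add_inj:
  assumes "cis (\<alpha> + s) = cis (\<alpha> + t)" "\<bar>s - t\<bar> < 2 * pi"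
  shows "s = t"
proof -
  have "cis s = cis t" using assms(1) by (simp flip: cis_mult)
  then have "cis (s - t) = 1" by (simp flip: cis_divide)
  \<comment> \<open>Here \<open>one_complex.simps\<close> is about the complex number 1, not about
    the space \<open>one_complex V E\<close>.\<close>
  then have "cos (s - t) = 1" by (metis cis.simps(1) one_complex.simps(1))
  then obtain n :: int where n: "s - t = of_int n * (2 * pi)"
    by (auto simp: cos_one_2pi_int mult_ac)
  with assms(2) have "\<bar>of_int n\<bar> < (1::real)"
    by (simp add: abs_mult)
  then have "n = 0" by (simp flip: of_int_abs)
  with n show ?thesis by simp
qed

text \<open>Turning counterclockwise from p, the circle is traced by \<open>p * cis t\<close> for t
  from 0 to 2 pi. If q is reached at the angle \<delta>, the arcs are the parts before and after
  \<delta>, the second one reversed.\<close>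

lemma sphere_split_arcs:
  fixes p q :: complex
  defines "S \<equiv> sphere (0::complex) 1"
  assumes pq: "p \<in> S" "q \<in> S" "p \<noteq> q"
  obtains A B where "arc_between (top_of_set S) A p q" "arc_between (top_of_set S) B p q"
    "A \<union> B = S" "A \<inter> B = {p, q}"
proof -
  have param: "\<exists>\<theta>. 0 \<le> \<theta> \<and> \<theta> < 2 * pi \<and> z = p * cis \<theta>" if "z \<in> S" for z
  proof (intro exI conjI)
    have "norm (z / p) = 1" "p \<noteq> 0" using that pq by (auto simp: S_def norm_divide)
    then show "z = p * cis (Arg2pi (z / p))"
      using Arg2pi_eq[of "z / p"] by (simp add: cis_conv_exp)
  qed (auto simp: Arg2pi_ge_0 Arg2pi_lt_2pi)
  define f where "f = (\<lambda>t. p * cis t)"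
  obtain \<delta> where \<delta>: "0 \<le> \<delta>" "\<delta> < 2 * pi" "q = f \<delta>" using param[OF pq(2)] by (auto simp: f_def)
  with pq(3) have \<delta>0: "0 < \<delta>" by (auto simp: f_def less_le)
  have f2pi: "f (2 * pi) = p" "f 0 = p" by (auto simp: f_def)
  have fS: "f t \<in> S" for t using pq(1) by (simp add: f_def S_def norm_mult)
  have inj: "s = t" if "f s = f t" "\<bar>s - t\<bar> < 2 * pi" for s t
    using that cis_add_inj[of 0 s t] pq(1) by (auto simp: f_def S_def)
  have cont: "continuous_map (top_of_set T) (top_of_set S) f" for T
    unfolding continuous_map_subtopology_eu using fS
    by (auto simp: f_def intro!: continuous_intros)
  have H: "Hausdorff_space (top_of_set S)" by (simp add: Hausdorff_space_subtopology)
  have "inj_on f {0..\<delta>}" "inj_on f {\<delta>..2 * pi}"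
    by (rule inj_onI, rule inj, use \<delta> \<delta>0 in auto)+
  then have A: "arc_between (top_of_set S) (f ` {0..\<delta>}) p q"
    and B: "arc_between (top_of_set S) (f ` {\<delta>..2 * pi}) p q"
    using arc_betweenI_interval[OF H \<delta>0 cont] arc_betweenI_interval[OF H \<delta>(2) cont]
    unfolding f2pi \<delta>(3)[symmetric] by (blast intro: arc_between_sym[OF H])+
  show thesis
  proof (rule that[OF A B])
    show "f ` {0..\<delta>} \<union> f ` {\<delta>..2 * pi} = S"
    proof
      show "S \<subseteq> f ` {0..\<delta>} \<union> f ` {\<delta>..2 * pi}"
      proof
        fix z assume "z \<in> S"
        then obtain t where t: "0 \<le> t" "t < 2 * pi" "z = f t" using param by (auto simp: f_def)
        then show "z \<in> f ` {0..\<delta>} \<union> f ` {\<delta>..2 * pi}" by (cases "t \<le> \<delta>") auto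
      qed
    qed (use fS in auto)
    show "f ` {0..\<delta>} \<inter> f ` {\<delta>..2 * pi} = {p, q}"
    proof
      show "{p, q} \<subseteq> f ` {0..\<delta>} \<inter> f ` {\<delta>..2 * pi}"
        using arc_between_ends(1,2)[OF A] arc_between_ends(1,2)[OF B] by auto
      show "f ` {0..\<delta>} \<inter> f ` {\<delta>..2 * pi} \<subseteq> {p, q}"
      proof
        fix x assume "x \<in> f ` {0..\<delta>} \<inter> f ` {\<delta>..2 * pi}"
        then obtain s t where st: "s \<in> {0..\<delta>}" "t \<in> {\<delta>..2*pi}" "f s = x" "f t = x" by auto
        \<comment> \<open>Below distance 2 pi the parametrisation is injective, which forces both
          parameters to be \<delta>. The only pair at distance 2 pi is 0 and 2 pi, and both give
          p.\<close>
        show "x \<in> {p, q}"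
        proof (cases "\<bar>s - t\<bar> < 2 * pi")
          case True
          then have "s = t" using inj st by metis
          then have "s = \<delta>" using st by auto
          then show ?thesis using st \<delta> by simp
        next
          case False
          then have "s = 0" using st by auto
          then show ?thesis using st f2pi by simp
        qed
      qed
    qed
  qed
qed

lemma arc_between_subtopology:
  "arc_between (subtopology X S) A a b \<longleftrightarrow> arc_between X A a b \<and> A \<subseteq> S"
  unfolding arc_between_def arc_map_def embedding_map_in_subtopology topspace_euclidean_subtopology
  by blast

lemma circle_in_split_arcs:
  assumes C: "circle_in X C" and pq: "p \<in> C" "q \<in> C" "p \<noteq> q"
  obtains A B where "arc_between X A p q" "arc_between X B p q" "A \<union> B = C" "A \<inter> B = {p, q}"
proof -
  let ?S = "top_of_set (sphere (0::complex) 1)"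
  have CX: "topspace (subtopology X C) = C"
    using C by (auto simp: circle_in_def)
  obtain h where h: "homeomorphic_map ?S (subtopology X C) h"
    using C homeomorphic_space_sym unfolding circle_in_def homeomorphic_space by blast
  have hS: "h ` sphere 0 1 = C" and inj: "inj_on h (sphere 0 1)"
    using homeomorphic_imp_surjective_map[OF h] homeomorphic_imp_injective_map[OF h] CX by auto
  obtain p' q' where p': "p' \<in> sphere 0 1" "q' \<in> sphere 0 1" "h p' = p" "h q' = q"
    using pq hS by (metis imageE)
  then have "p' \<noteq> q'" using pq by auto
  with p' obtain A B where AB: "arc_between ?S A p' q'" "arc_between ?S B p' q'"
    "A \<union> B = sphere 0 1" "A \<inter> B = {p', q'}"
    using sphere_split_arcs by metis
  have "h ` A \<inter> h ` B = {p, q}"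
    using inj_on_image_Int[OF inj, of A B] AB(3,4) p'(3,4) by auto
  moreover have "h ` A \<union> h ` B = C" using AB(3) hS by (simp flip: image_Un)
  moreover have "arc_between X (h ` A) p q" "arc_between X (h ` B) p q"
    using arc_between_homeomorphic_image[OF h AB(1)] arc_between_homeomorphic_image[OF h AB(2)]
    unfolding arc_between_subtopology p'(3,4) by blast+
  ultimately show thesis by (intro that)
qed


section \<open>Spaces in which any two points lie on a circle\<close>

lemma circle_in_closedin:
  assumes "Hausdorff_space X" "circle_in X C"
  shows "closedin X C"
proof -
  have "compact_space (top_of_set (sphere (0::complex) 1))"
    by (simp add: compact_space_subtopology compactin_euclidean_iff)
  then have "compact_space (subtopology X C)"
    using assms(2) homeomorphic_compact_space unfolding circle_in_def by blast
  then have "compactin X C"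
    using assms(2) by (auto simp: circle_in_def compact_space_subtopology compactin_subspace)
  then show ?thesis using assms(1) by (rule compactin_imp_closedin[rotated])
qed

lemma circle_in_other_point:
  assumes "circle_in X C"
  obtains q where "q \<in> C" "q \<noteq> p"
proof -
  let ?S = "top_of_set (sphere (0::complex) 1)"
  obtain h where h: "homeomorphic_map ?S (subtopology X C) h"
    using assms homeomorphic_space_sym unfolding circle_in_def homeomorphic_space by blast
  have "h ` sphere 0 1 = C" "inj_on h (sphere 0 1)"
    using homeomorphic_imp_surjective_map[OF h] homeomorphic_imp_injective_map[OF h] assms
    by (auto simp: circle_in_def)
  then have "h 1 \<in> C" "h (-1) \<in> C" "h 1 \<noteq> h (-1)"
    by (auto dest: inj_onD[of h _ 1 "-1"])
  then show thesis using that by metis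
qed

text \<open>One of the two arcs of C between p and q contains r. The other one serves as P, and the
  part of the first between q and r serves as Q.\<close>

lemma circle_in_chain:
  assumes X: "Hausdorff_space X" and C: "circle_in X C" and pqr: "p \<in> C" "q \<in> C" "r \<in> C"
    "p \<noteq> q" "q \<noteq> r" "p \<noteq> r"
  obtains P Q where "arc_between X P p q" "arc_between X Q q r" "P \<inter> Q = {q}" "P \<union> Q \<subseteq> C"
proof -
  note goal = that
  have *: thesis if A: "arc_between X A p q" and B: "arc_between X B p q" and AB: "A \<union> B = C" "A \<inter> B = {p, q}"
    and r: "r \<in> B" for A B
  proof -
    from r pqr obtain B1 B2 where B12: "arc_between X B1 p r" "arc_between X B2 r q" "B1 \<union> B2 = B" "B1 \<inter> B2 = {r}"
      using arc_between_split[OF X B] by metis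
    show thesis
    proof (rule goal[OF A arc_between_sym[OF X B12(2)]])
      have "p \<notin> B2" using B12(4) pqr arc_between_ends(1)[OF B12(1)] by blast
      then show "A \<inter> B2 = {q}"
        using equalityD1[OF AB(2)] equalityD1[OF B12(3)] arc_between_ends(2)[OF A]
          arc_between_ends(2)[OF B12(2)] by blast
      show "A \<union> B2 \<subseteq> C" using AB B12 by blast
    qed
  qed
  obtain A B where "arc_between X A p q" "arc_between X B p q" "A \<union> B = C" "A \<inter> B = {p, q}"
    using circle_in_split_arcs[OF C pqr(1,2,4)] .
  then show thesis using *[of A B] *[of B A] pqr(3) by blast
qed

lemma n_cc_2_pair:
  assumes "n_cc 2 X" "u \<in> topspace X" "v \<in> topspace X"
  obtains C where "circle_in X C" "u \<in> C" "v \<in> C"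
proof -
  have "card {u, v} \<le> 2" by (simp add: card_insert_if)
  then obtain C where "circle_in X C" "{u, v} \<subseteq> C"
    using assms(1)[unfolded n_cc_def, rule_format, of "{u, v}"] assms(2,3) by auto
  then show thesis using that by simp
qed

lemma n_cc_2_chain:
  assumes X: "Hausdorff_space X" and cc: "n_cc 2 X"
    and xyz: "x \<in> topspace X" "y \<in> topspace X" "z \<in> topspace X" "x \<noteq> y" "y \<noteq> z" "x \<noteq> z"
  obtains P Q where "arc_between X P x y" "arc_between X Q y z" "P \<inter> Q = {y}"
proof -
  note goal = that
  obtain K where K: "circle_in X K" "x \<in> K" "y \<in> K" using n_cc_2_pair[OF cc] xyz by metis
  have closed: "closedin X K" by (rule circle_in_closedin[OF X K(1)])
  \<comment> \<open>L comes from z and touches K only in c. If c = y, any arc of K from x to y can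
    be continued along L; otherwise K contains arcs from x to y and on to c, and L is appended at
    c.\<close>
  have hit: thesis if L: "arc_between X L z c" "L \<inter> K = {c}" and c: "c \<noteq> x" for L c
  proof (cases "c = y")
    case True
    obtain P where P: "arc_between X P x y" "P \<subseteq> K"
      using circle_in_split_arcs[OF K(1-3) xyz(4)] by blast
    have L': "arc_between X L y z" using arc_between_sym[OF X L(1)] True by simp
    have "P \<inter> L = {y}" using P L(2) arc_between_ends(2)[OF P(1)] True by blast
    with P(1) L' show thesis by (rule goal)
  next
    case False
    have cK: "c \<in> K" using L by blast
    obtain P Q where PQ: "arc_between X P x y" "arc_between X Q y c" "P \<inter> Q = {y}" "P \<union> Q \<subseteq> K"
      using circle_in_chain[OF X K(1-3) cK xyz(4)] False c by metis
    have "Q \<inter> L = {c}"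
      using PQ(4) L(2) arc_between_ends(2)[OF PQ(2)] by blast
    then have "arc_between X (Q \<union> L) y z"
      by (rule arc_between_join[OF X PQ(2) arc_between_sym[OF X L(1)]])
    moreover have "P \<inter> (Q \<union> L) = {y}"
    proof -
      have "c \<notin> P" using PQ(3) False arc_between_ends(2)[OF PQ(2)] by blast
      then show ?thesis using equalityD1[OF PQ(3)] PQ(4) equalityD1[OF L(2)]
          arc_between_ends(2)[OF PQ(1)] arc_between_ends(1)[OF PQ(2)] by blast
    qed
    ultimately show thesis by (rule goal[OF PQ(1)])
  qed
  show thesis
  proof (cases "z \<in> K")
    case True
    show thesis using circle_in_chain[OF X K True xyz(4,5,6)] that by metis
  next
    case False
    obtain K' where K': "circle_in X K'" "z \<in> K'" "y \<in> K'"
      using n_cc_2_pair[OF cc] xyz by metis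
    obtain L M where LM: "arc_between X L z y" "arc_between X M z y" "L \<inter> M = {z, y}"
      using circle_in_split_arcs[OF K' xyz(5)[symmetric]] by metis
    obtain c L' where c: "arc_between X L' z c" "L' \<subseteq> L" "L' \<inter> K = {c}"
      using arc_between_first_hit[OF X LM(1) closed False K(3)] .
    obtain d M' where d: "arc_between X M' z d" "M' \<subseteq> M" "M' \<inter> K = {d}"
      using arc_between_first_hit[OF X LM(2) closed False K(3)] .
    have "c \<in> L" "d \<in> M" using c d by blast+
    \<comment> \<open>L and M share only z and y, both different from x, so they cannot both hit K
      first in x.\<close>
    then have "c \<noteq> x \<or> d \<noteq> x" using LM(3) xyz by blast
    then show thesis using hit c d by blast
  qed
qed

lemma n_cc_2_imp_n_sac_3:
  assumes X: "Hausdorff_space X" and cc: "n_cc 2 X"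
  shows "n_sac 3 X"
  unfolding n_sac_def
proof (intro allI impI, elim conjE)
  fix xs :: "'a list"
  assume xs: "set xs \<subseteq> topspace X" "distinct xs" "length xs \<le> 3"
  \<comment> \<open>The empty list and one-point lists need an arc as well. It is cut out of a
    circle, with an arbitrary second point of the circle as its other end.\<close>
  have short: "\<exists>f. arc_map X f \<and> (xs = [] \<or> xs = [f 0])" if "length xs \<le> 1"
  proof -
    have "finite (set xs)" "card (set xs) \<le> 2" using that card_length[of xs] by auto
    then obtain C where C: "circle_in X C" "set xs \<subseteq> C" using cc xs unfolding n_cc_def by blast
    obtain p where p: "p \<in> C" "xs = [] \<or> xs = [p]"
    proof (cases xs)
      case Nil
      then show ?thesis using that circle_in_other_point[OF C(1)] by metis
    next
      case (Cons a ys)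
      then show ?thesis using that \<open>length xs \<le> 1\<close> C by auto
    qed
    obtain q where "q \<in> C" "q \<noteq> p" using circle_in_other_point[OF C(1)] .
    then obtain A where "arc_between X A p q" using circle_in_split_arcs[OF C(1)] p by metis
    then show ?thesis using p(2) unfolding arc_between_def by auto
  qed
  consider "xs = []" | x where "xs = [x]" | x y where "xs = [x, y]" | x y z where "xs = [x, y, z]"
    using xs(3) by (cases xs rule: list.exhaust; cases "tl xs"; cases "tl (tl xs)") auto
  then show "\<exists>f ts. arc_map X f \<and> set ts \<subseteq> {0..1} \<and> sorted_wrt (<) ts \<and> map f ts = xs"
  proof cases
    case 1
    then show ?thesis using short by force
  next
    case (2 x)
    then obtain f where "arc_map X f" "f 0 = x" using short by auto
    then show ?thesis using 2 by (intro exI[of _ f] exI[of _ "[0]"]) auto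
  next
    case (3 x y)
    then have "x \<in> topspace X" "y \<in> topspace X" "x \<noteq> y" using xs by auto
    then obtain C where "circle_in X C" "x \<in> C" "y \<in> C" using n_cc_2_pair[OF cc] by metis
    then obtain A where "arc_between X A x y" using circle_in_split_arcs \<open>x \<noteq> y\<close> by metis
    then obtain f where "arc_map X f" "f 0 = x" "f 1 = y" unfolding arc_between_def by blast
    then show ?thesis using 3 by (intro exI[of _ f] exI[of _ "[0, 1]"]) auto
  next
    case (4 x y z)
    then have "x \<in> topspace X" "y \<in> topspace X" "z \<in> topspace X" "x \<noteq> y" "y \<noteq> z" "x \<noteq> z"
      using xs by auto
    then obtain P Q where "arc_between X P x y" "arc_between X Q y z" "P \<inter> Q = {y}"
      by (rule n_cc_2_chain[OF X cc])
    then obtain f where "arc_map X f" "f 0 = x" "f (1/2) = y" "f 1 = z"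
      using arc_between_concat[OF X] by metis
    then show ?thesis using 4 by (intro exI[of _ f] exI[of _ "[0, 1/2, 1]"]) auto
  qed
qed

lemma n_cc_2_imp_three_points:
  assumes X: "Hausdorff_space X" and cc: "n_cc 2 X"
  shows "three_points_on_circle_or_theta X"
  unfolding three_points_on_circle_or_theta_def
proof (intro ballI)
  fix x y z assume xyz: "x \<in> topspace X" "y \<in> topspace X" "z \<in> topspace X"
  obtain K where K: "circle_in X K" "x \<in> K" "z \<in> K" using n_cc_2_pair[OF cc] xyz by metis
  have closed: "closedin X K" by (rule circle_in_closedin[OF X K(1)])
  show "\<exists>C. (circle_in X C \<or> theta_curve_in X C) \<and> {x, y, z} \<subseteq> C"
  \<comment> \<open>In the first case a circle does: K itself if it contains y, and a circle through
    x and y if x = z. In the second case the three points are distinct, as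
    \<open>n_cc_2_chain\<close> requires.\<close>
  proof (cases "y \<in> K \<or> x = z")
    case True
    obtain C where "circle_in X C" "x \<in> C" "y \<in> C" using n_cc_2_pair[OF cc xyz(1,2)] .
    then show ?thesis using True K by blast
  next
    case False
    then have ne: "x \<noteq> y" "y \<noteq> z" "x \<noteq> z" "y \<notin> K" using K by auto
    obtain P Q where PQ: "arc_between X P x y" "arc_between X Q y z" "P \<inter> Q = {y}"
      using n_cc_2_chain[OF X cc xyz ne(1-3)] .
    obtain a P' where a: "arc_between X P' y a" "P' \<subseteq> P" "P' \<inter> K = {a}"
      using arc_between_first_hit[OF X arc_between_sym[OF X PQ(1)] closed ne(4) K(2)] .
    obtain b Q' where b: "arc_between X Q' y b" "Q' \<subseteq> Q" "Q' \<inter> K = {b}"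
      using arc_between_first_hit[OF X PQ(2) closed ne(4) K(3)] .
    have P'Q': "P' \<inter> Q' = {y}"
      using a b PQ(3) arc_between_ends(1)[OF a(1)] arc_between_ends(1)[OF b(1)] by blast
    \<comment> \<open>The third arc of the theta curve: it leaves K in a, passes through y and
      returns in b. As ends of an arc, a and b are distinct, so K splits at them into the other two
      arcs.\<close>
    have R: "arc_between X (P' \<union> Q') a b"
      by (rule arc_between_join[OF X arc_between_sym[OF X a(1)] b(1) P'Q'])
    have RK: "(P' \<union> Q') \<inter> K = {a, b}" using a(3) b(3) by blast
    have "a \<in> K" "b \<in> K" using a(3) b(3) by auto
    then obtain A B where AB: "arc_between X A a b" "arc_between X B a b" "A \<union> B = K" "A \<inter> B = {a, b}"
      using circle_in_split_arcs[OF K(1)] arc_between_ends(3)[OF R] by metis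
    have ends: "{a, b} \<subseteq> A" "{a, b} \<subseteq> B" using AB by auto
    let ?T = "A \<union> B \<union> (P' \<union> Q')"
    have T: "?T \<subseteq> topspace X"
      using arc_between_ends(4)[OF AB(1)] arc_between_ends(4)[OF AB(2)] arc_between_ends(4)[OF R] by blast
    have "theta_space (subtopology X ?T)"
      unfolding theta_space_def
    proof (intro exI conjI)
      show "arc_between (subtopology X ?T) A a b" "arc_between (subtopology X ?T) B a b"
        "arc_between (subtopology X ?T) (P' \<union> Q') a b"
        using AB R by (auto simp: arc_between_subtopology)
      show "A \<inter> B = {a, b}" by fact
      show "A \<inter> (P' \<union> Q') = {a, b}" "B \<inter> (P' \<union> Q') = {a, b}" using RK AB(3) ends by blast+
      show "topspace (subtopology X ?T) = ?T" using T by auto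
    qed
    then have "theta_curve_in X ?T" using T by (simp add: theta_curve_in_def)
    moreover have "{x, y, z} \<subseteq> ?T" using K AB(3) arc_between_ends(1)[OF a(1)] by auto
    ultimately show ?thesis by blast
  qed
qed

section \<open>Joining two points by a connected set that avoids a third\<close>

definition joined_avoiding :: "'b topology \<Rightarrow> 'b \<Rightarrow> 'b \<Rightarrow> 'b \<Rightarrow> bool" where
  "joined_avoiding X v u w \<longleftrightarrow> (\<exists>S. connectedin X S \<and> u \<in> S \<and> w \<in> S \<and> v \<notin> S)"

lemma joined_avoiding_sym: "joined_avoiding X v u w \<Longrightarrow> joined_avoiding X v w u"
  unfolding joined_avoiding_def by blast

text \<open>This is the gain over joining by arcs: two arcs with a common end may meet in many
  further points, while the union of two connected sets with a common point is connected.\<close>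

lemma joined_avoiding_trans:
  assumes "joined_avoiding X v u w" "joined_avoiding X v w x"
  shows "joined_avoiding X v u x"
proof -
  obtain S T where "connectedin X S" "u \<in> S" "w \<in> S" "v \<notin> S" "connectedin X T" "w \<in> T" "x \<in> T" "v \<notin> T"
    using assms unfolding joined_avoiding_def by blast
  then show ?thesis
    unfolding joined_avoiding_def by (intro exI[of _ "S \<union> T"]) (auto intro: connectedin_Un)
qed

lemma arc_between_joined_avoiding:
  assumes "arc_between X A a b" "v \<notin> A"
  shows "joined_avoiding X v a b"
  using arc_between_connectedin[OF assms(1)] arc_between_ends[OF assms(1)] assms(2)
  unfolding joined_avoiding_def by (intro exI[of _ A] conjI)

text \<open>The two parts of the arc at u share only u, so v can block at most one of them.\<close>

lemma arc_between_joined_to_end: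
  assumes X: "Hausdorff_space X" and A: "arc_between X A a b" and u: "u \<in> A" "u \<noteq> v"
  shows "joined_avoiding X v u a \<or> joined_avoiding X v u b"
proof (cases "u = a \<or> u = b")
  case True
  have "joined_avoiding X v u u"
    using u arc_between_ends(4)[OF A] unfolding joined_avoiding_def
    by (intro exI[of _ "{u}"]) auto
  then show ?thesis using True by blast
next
  case False
  with u obtain B C where BC: "arc_between X B a u" "arc_between X C u b" "B \<inter> C = {u}"
    using arc_between_split[OF X A] by metis
  then have "v \<notin> B \<or> v \<notin> C" using u by (metis IntI singletonD)
  then show ?thesis
    using arc_between_joined_avoiding[OF BC(1)] arc_between_joined_avoiding[OF BC(2)]
      joined_avoiding_sym by metis
qed

lemma circle_in_joined_avoiding:
  assumes "circle_in X C" "u \<in> C" "w \<in> C" "u \<noteq> w" "u \<noteq> v" "w \<noteq> v"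
  shows "joined_avoiding X v u w"
proof -
  obtain A B where AB: "arc_between X A u w" "arc_between X B u w" "A \<inter> B = {u, w}"
    using circle_in_split_arcs[OF assms(1-4)] by metis
  then have "v \<notin> A \<or> v \<notin> B" using assms by (metis IntI insertE singletonD)
  then show ?thesis using AB arc_between_joined_avoiding by metis
qed

text \<open>Every point other than v reaches a branch point along its own arc. If v is not a branch
  point, it lies on at most one of A1 and A2, and the other one joins a to b.\<close>

lemma theta_curve_in_joined_avoiding:
  assumes X: "Hausdorff_space X" and T: "theta_curve_in X T" and uw: "u \<in> T" "w \<in> T" "u \<noteq> v" "w \<noteq> v"
  shows "joined_avoiding X v u w"
proof -
  obtain a b A1 A2 A3 where A: "arc_between X A1 a b" "arc_between X A2 a b" "arc_between X A3 a b"
    "A1 \<inter> A2 = {a, b}" "T = A1 \<union> A2 \<union> A3"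
    using T unfolding theta_curve_in_def theta_space_def arc_between_subtopology
    by (auto simp: inf_absorb2)
  \<comment> \<open>If v is itself a branch point, the alternatives ending in v are void, so u and w
    both reach the other branch point.\<close>
  have not_v: "\<not> joined_avoiding X v x v" for x by (auto simp: joined_avoiding_def)
  have to_end: "joined_avoiding X v x a \<or> joined_avoiding X v x b" if "x \<in> T" "x \<noteq> v" for x
    using that A(5) arc_between_joined_to_end[OF X A(1)] arc_between_joined_to_end[OF X A(2)]
      arc_between_joined_to_end[OF X A(3)] by blast
  have ends: "joined_avoiding X v a b \<or> v = a \<or> v = b"
    using A(4) arc_between_joined_avoiding[OF A(1), of v] arc_between_joined_avoiding[OF A(2), of v] by blast
  show ?thesis
    using to_end[OF uw(1,3)] to_end[OF uw(2,4)] ends not_v joined_avoiding_sym joined_avoiding_trans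
    by metis
qed

text \<open>The order of the points is what matters: on an arc through v, u, w in this order, the
  piece from u to w comes after v and so misses it.\<close>

lemma n_sac_3_joined_avoiding:
  assumes sac: "n_sac 3 X" and uw: "u \<in> topspace X" "w \<in> topspace X" "u \<noteq> w" "u \<noteq> v" "w \<noteq> v"
  shows "joined_avoiding X v u w"
proof -
  have conn: "connectedin X (f ` {s..t})" if "arc_map X f" "{s..t} \<subseteq> {0..1}" for f s t
    using that(2) by (intro connectedin_continuous_map_image[OF arc_map_continuous[OF that(1)]])
      (auto simp: connectedin_subtopology)
  show ?thesis
  proof (cases "v \<in> topspace X")
    case True
    have "\<exists>f ts. arc_map X f \<and> set ts \<subseteq> {0..1} \<and> sorted_wrt (<) ts \<and> map f ts = [v, u, w]"
      by (rule sac[unfolded n_sac_def, rule_format]) (use True uw in auto)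
    then obtain f ts where f: "arc_map X f" "set ts \<subseteq> {0..1}" "sorted_wrt (<) ts" "map f ts = [v, u, w]"
      by (elim exE conjE) (rule that)
    then obtain r s t where ts: "ts = [r, s, t]" by (auto simp: map_eq_Cons_conv)
    have sub: "{s..t} \<subseteq> {0..1}" using f ts by auto
    have "v \<notin> f ` {s..t}"
    proof
      assume "v \<in> f ` {s..t}"
      then obtain x where x: "x \<in> {s..t}" "f x = f r" using f ts by auto
      then have "x = r" using inj_onD[OF arc_map_inj[OF f(1)]] f(2) ts sub by auto
      then show False using x f ts by auto
    qed
    then show ?thesis
      using conn[OF f(1) sub] f ts unfolding joined_avoiding_def
      by (intro exI[of _ "f ` {s..t}"]) auto
  next
    \<comment> \<open>A v outside the space is avoided by every connected set. This case yields
      plain connectedness, i.e. the deletion of no vertex.\<close>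
    case False
    have "\<exists>f ts. arc_map X f \<and> set ts \<subseteq> {0..1} \<and> sorted_wrt (<) ts \<and> map f ts = [u, w]"
      by (rule sac[unfolded n_sac_def, rule_format]) (use uw in auto)
    then obtain f ts where f: "arc_map X f" "set ts \<subseteq> {0..1}" "sorted_wrt (<) ts" "map f ts = [u, w]"
      by (elim exE conjE) (rule that)
    then obtain s t where ts: "ts = [s, t]" by (auto simp: map_eq_Cons_conv)
    have sub: "{s..t} \<subseteq> {0..1}" using f ts by auto
    have "v \<notin> f ` {s..t}" using connectedin_subset_topspace[OF conn[OF f(1) sub]] False by blast
    then show ?thesis
      using conn[OF f(1) sub] f ts unfolding joined_avoiding_def
      by (intro exI[of _ "f ` {s..t}"]) auto
  qed
qed

lemma n_cc_2_joined_avoiding: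
  assumes "n_cc 2 X" "u \<in> topspace X" "w \<in> topspace X" "u \<noteq> w" "u \<noteq> v" "w \<noteq> v"
  shows "joined_avoiding X v u w"
  using n_cc_2_pair[OF assms(1-3)] circle_in_joined_avoiding assms(4-) by metis

lemma three_points_joined_avoiding:
  assumes X: "Hausdorff_space X" and three: "three_points_on_circle_or_theta X"
    and uw: "u \<in> topspace X" "w \<in> topspace X" "u \<noteq> w" "u \<noteq> v" "w \<noteq> v"
  shows "joined_avoiding X v u w"
proof -
  obtain C where "circle_in X C \<or> theta_curve_in X C" "{u, w, w} \<subseteq> C"
    using three[unfolded three_points_on_circle_or_theta_def, rule_format, OF uw(1,2,2)]
    by (elim exE conjE) (rule that)
  then have "circle_in X C \<or> theta_curve_in X C" "u \<in> C" "w \<in> C" by auto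
  then show ?thesis
    using circle_in_joined_avoiding theta_curve_in_joined_avoiding[OF X] uw by metis
qed


section \<open>The 1-complex\<close>

text \<open>On |G| continuous functions are easier to write down than disjoint neighbourhoods, which
  at a vertex have to be chosen along possibly infinitely many edges.\<close>

lemma Hausdorff_space_real_separation:
  assumes "\<And>x y. x \<in> topspace X \<Longrightarrow> y \<in> topspace X \<Longrightarrow> x \<noteq> y \<Longrightarrow>
    \<exists>f. continuous_map X euclideanreal f \<and> f x \<noteq> f y"
  shows "Hausdorff_space X"
  unfolding Hausdorff_space_def
proof (intro allI impI, elim conjE)
  fix x y assume xy: "x \<in> topspace X" "y \<in> topspace X" "x \<noteq> y"
  then obtain f where f: "continuous_map X euclideanreal f" "f x \<noteq> f y" using assms by blast
  then obtain U W where UW: "open U" "open W" "f x \<in> U" "f y \<in> W" "U \<inter> W = {}"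
    using hausdorff[of "f x" "f y"] by metis
  show "\<exists>U V. openin X U \<and> openin X V \<and> x \<in> U \<and> y \<in> V \<and> disjnt U V"
  proof (intro exI conjI)
    show "openin X {z \<in> topspace X. f z \<in> U}" "openin X {z \<in> topspace X. f z \<in> W}"
      using UW by (auto intro!: openin_continuous_map_preimage[OF f(1)])
    show "disjnt {z \<in> topspace X. f z \<in> U} {z \<in> topspace X. f z \<in> W}"
      using UW(5) by (auto simp: disjnt_def)
  qed (use UW xy in auto)
qed

lemma simple_graph_edge:
  assumes "simple_graph V E" "e \<in> E"
  shows "e = {tail_of e, head_of e}" "tail_of e \<noteq> head_of e" "tail_of e \<in> V" "head_of e \<in> V"
    "e \<subseteq> V"
proof -
  have e: "e \<subseteq> V" "card e = 2" using assms by (auto simp: simple_graph_def)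
  from edge_eq_tail_head[OF e(2)] show "e = {tail_of e, head_of e}" "tail_of e \<noteq> head_of e" .
  with e show "tail_of e \<in> V" "head_of e \<in> V" "e \<subseteq> V" by auto
qed

lemma topspace_pre_complex:
  "topspace (pre_complex V E) = Inl ` V \<times> {0} \<union> Inr ` E \<times> {0..1}"
  by (auto simp: pre_complex_def)

lemma topspace_one_complex:
  assumes "simple_graph V E"
  shows "topspace (one_complex V E) = Inl ` V \<times> {0} \<union> Inr ` E \<times> {0<..<1}"
proof -
  have "glue (Inr e, t) \<in> Inl ` V \<times> {0} \<union> Inr ` E \<times> {0<..<1}" if "e \<in> E" "t \<in> {0..1}" for e t
    using that simple_graph_edge[OF assms that(1)] by auto
  moreover have "(Inr e, t) \<in> glue ` (Inr ` E \<times> {0..1})" if "e \<in> E" "t \<in> {0<..<1}" for e t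
    using that by (intro image_eqI[of _ _ "(Inr e, t)"]) auto
  moreover have "(Inl v, 0) \<in> glue ` (Inl ` V \<times> {0})" if "v \<in> V" for v :: 'a
    using that by (intro image_eqI[of _ _ "(Inl v, 0)"]) auto
  moreover have "glue (Inl v, 0) \<in> Inl ` V \<times> {0}" if "v \<in> V" for v :: 'a using that by simp
  ultimately show ?thesis
    unfolding one_complex_def topspace_quotient_topology topspace_pre_complex image_Un
    by (intro subset_antisym subsetI) (fastforce simp del: glue.simps)+
qed

text \<open>The universal property of the quotient. Before gluing, every vertex is a one-point
  summand, so vertices only have to be mapped into Y; continuity at a vertex is encoded in the
  edges, through \<open>glue\<close>.\<close>

lemma continuous_map_one_complex:
  assumes "\<And>e. e \<in> E \<Longrightarrow> continuous_map (top_of_set {0..1}) Y (\<lambda>t. f (glue (Inr e, t)))"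
    and "\<And>v. v \<in> V \<Longrightarrow> f (Inl v, 0) \<in> topspace Y"
  shows "continuous_map (one_complex V E) Y f"
proof -
  have "continuous_map (pre_complex V E) Y (f \<circ> glue)"
    unfolding continuous_map_def
  proof (intro conjI allI impI)
    show "f \<circ> glue \<in> topspace (pre_complex V E) \<rightarrow> topspace Y"
      using assms(2) continuous_map_funspace[OF assms(1)]
      by (auto simp: topspace_pre_complex Pi_iff)
    fix U assume U: "openin Y U"
    show "openin (pre_complex V E) {x \<in> topspace (pre_complex V E). (f \<circ> glue) x \<in> U}"
      unfolding pre_complex_def openin_sum_topology
    proof (intro conjI ballI)
      fix i assume i: "i \<in> V <+> E"
      let ?I = "case_sum (\<lambda>v. top_of_set {0}) (\<lambda>e. top_of_set {0..1::real})"
      define W where "W = {x. (i, x) \<in> {x \<in> topspace (sum_topology ?I (V <+> E)). (f \<circ> glue) x \<in> U}}"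
      show "openin (?I i) W"
      proof (cases i)
        case (Inl v)
        then have "W = {} \<or> W = {0}" unfolding W_def by auto
        then show ?thesis using Inl openin_topspace[of "?I i"] by auto
      next
        case (Inr e)
        then have e: "e \<in> E" using i by auto
        have "W = {t \<in> topspace (top_of_set {0..1}). f (glue (Inr e, t)) \<in> U}"
          using Inr e unfolding W_def by auto
        then show ?thesis
          using openin_continuous_map_preimage[OF assms(1)[OF e] U] Inr by simp
      qed
    qed auto
  qed
  then show ?thesis by (rule continuous_compose_quotient_map[OF quotient_map_glue])
qed

definition extend_to_complex :: "('a \<Rightarrow> 'b) \<Rightarrow> ('a set \<Rightarrow> real \<Rightarrow> 'b) \<Rightarrow> 'a complex_point \<Rightarrow> 'b" where
  "extend_to_complex g k p = (case p of (Inl v, t) \<Rightarrow> g v | (Inr e, t) \<Rightarrow> k e t)"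

lemma extend_to_complex_simps [simp]:
  "extend_to_complex g k (Inl v, t) = g v" "extend_to_complex g k (Inr e, t) = k e t"
  by (simp_all add: extend_to_complex_def)

lemma continuous_map_extend_to_complex:
  fixes g :: "'a \<Rightarrow> real"
  assumes "\<And>e. e \<in> E \<Longrightarrow> continuous_on {0..1} (k e)"
    and "\<And>e. e \<in> E \<Longrightarrow> k e 0 = g (tail_of e) \<and> k e 1 = g (head_of e)"
  shows "continuous_map (one_complex V E) euclideanreal (extend_to_complex g k)"
proof (rule continuous_map_one_complex)
  fix e assume "e \<in> E"
  then have "extend_to_complex g k (glue (Inr e, t)) = k e t" for t
    using assms(2) by auto
  then show "continuous_map (top_of_set {0..1}) euclideanreal (\<lambda>t. extend_to_complex g k (glue (Inr e, t)))"
    using assms(1) \<open>e \<in> E\<close> by simp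
qed simp

definition linear_extension :: "('a \<Rightarrow> real) \<Rightarrow> 'a complex_point \<Rightarrow> real" where
  "linear_extension g =
     extend_to_complex g (\<lambda>e t. (1 - t) * g (tail_of e) + t * g (head_of e))"

lemma continuous_map_linear_extension:
  "continuous_map (one_complex V E) euclideanreal (linear_extension g)"
  unfolding linear_extension_def
  by (rule continuous_map_extend_to_complex) (auto intro!: continuous_intros)

text \<open>Meant for contradictions: if g is chosen so that its linear extension vanishes at most
  in p, then no connected set avoiding p contains both u and w.\<close>

lemma linear_extension_zero:
  assumes "joined_avoiding (one_complex V E) p (Inl u, 0) (Inl w, 0)" "0 < g u" "g w < 0"
  shows "\<exists>z \<in> topspace (one_complex V E). z \<noteq> p \<and> linear_extension g z = 0"
proof -
  obtain S where S: "connectedin (one_complex V E) S" "(Inl u, 0) \<in> S" "(Inl w, 0) \<in> S" "p \<notin> S"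
    using assms(1) by (auto simp: joined_avoiding_def)
  have "connected (linear_extension g ` S)"
    using connectedin_continuous_map_image[OF continuous_map_linear_extension S(1), of g] by simp
  moreover have "linear_extension g (Inl u, 0) \<in> linear_extension g ` S"
    "linear_extension g (Inl w, 0) \<in> linear_extension g ` S" using S by blast+
  ultimately have "0 \<in> linear_extension g ` S"
    using connectedD_interval[of "linear_extension g ` S" "g w" "g u" 0] assms(2,3)
    by (auto simp: linear_extension_def)
  then show ?thesis using S(4) connectedin_subset_topspace[OF S(1)] by force
qed

lemma Hausdorff_space_one_complex:
  assumes G: "simple_graph V E"
  shows "Hausdorff_space (one_complex V E)"
proof (rule Hausdorff_space_real_separation)
  let ?X = "one_complex V E"
  have vertex: "\<exists>f. continuous_map ?X euclideanreal f \<and> f (Inl v, 0) \<noteq> f (Inl w, 0)" if "v \<noteq> w" for v w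
    using that continuous_map_linear_extension[of V E "\<lambda>x. if x = v then 1 else 0"]
    by (intro exI[of _ "linear_extension (\<lambda>x. if x = v then 1 else 0)"])
      (auto simp: linear_extension_def)
  have inner: "\<exists>f. continuous_map ?X euclideanreal f \<and> f (Inr e, t) \<noteq> f y"
    if "0 < t" "t < 1" "y \<noteq> (Inr e, t)" "y \<in> topspace ?X" for e t y
  proof -
    \<comment> \<open>The bumps \<open>s ^ n * (1 - s)\<close> with positive n vanish at both ends
      of e and hence extend by 0. A nonzero value identifies the edge, and the ratio of the bumps
      for n = 2 and n = 1 is the parameter s, so these two functions determine the interior
      point.\<close>
    define F where "F = (\<lambda>n. extend_to_complex (\<lambda>_. 0 :: real) (\<lambda>e' s. if e' = e then s ^ n * (1 - s) else 0))"
    have cont: "continuous_map ?X euclideanreal (F n)" if "0 < n" for n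
      unfolding F_def
    proof (rule continuous_map_extend_to_complex)
      show "continuous_on {0..1} (\<lambda>s::real. if e' = e then s ^ n * (1 - s) else 0)" for e'
        by (cases "e' = e") (auto intro!: continuous_intros)
    qed (use that in auto)
    have pos: "F n (Inr e, t) \<noteq> 0" for n using that by (simp add: F_def)
    have "F 1 (Inr e, t) \<noteq> F 1 y \<or> F 2 (Inr e, t) \<noteq> F 2 y"
    proof (rule ccontr)
      assume "\<not> ?thesis"
      then have eq: "F 1 (Inr e, t) = F 1 y" "F 2 (Inr e, t) = F 2 y" by auto
      obtain s where y: "y = (Inr e, s)"
        using pos[of 1] eq(1) by (cases y; cases "fst y") (auto simp: F_def split: if_splits)
      have "t * (t * (1 - t)) = s * (s * (1 - s))" "t * (1 - t) = s * (1 - s)"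
        using eq y by (simp_all add: F_def power2_eq_square mult.assoc)
      then have "t * (t * (1 - t)) = s * (t * (1 - t))" by simp
      then have "t = s" using that(1,2) by simp
      then show False using y that(3) by simp
    qed
    then show ?thesis using cont[of 1] cont[of 2] by auto
  qed
  fix x y assume xy: "x \<in> topspace ?X" "y \<in> topspace ?X" "x \<noteq> y"
  have cases: "(\<exists>v. z = (Inl v, 0)) \<or> (\<exists>e t. z = (Inr e, t) \<and> 0 < t \<and> t < 1)" if "z \<in> topspace ?X" for z
    using that by (auto simp: topspace_one_complex[OF G])
  show "\<exists>f. continuous_map ?X euclideanreal f \<and> f x \<noteq> f y"
    using cases[OF xy(1)] cases[OF xy(2)] vertex inner xy by metis
qed

section \<open>Edges and paths as arcs, cycles as circles\<close>

definition edge_space :: "'a set \<Rightarrow> 'a complex_point set" where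
  "edge_space e = Inl ` e \<times> {0} \<union> {Inr e} \<times> {0<..<1}"

lemma arc_between_edge_space:
  assumes G: "simple_graph V E" and uv: "{u, v} \<in> E"
  shows "arc_between (one_complex V E) (edge_space {u, v}) (Inl u, 0) (Inl v, 0)"
proof -
  let ?X = "one_complex V E" and ?e = "{u, v}"
  note e = simple_graph_edge[OF G uv]
  have X: "Hausdorff_space ?X" by (rule Hausdorff_space_one_complex[OF G])
  have "Inr ?e \<in> V <+> E" using uv by auto
  then have "continuous_map (top_of_set {0..1}) (pre_complex V E) (\<lambda>t. (Inr ?e, t))"
    using continuous_map_component_injection[of "Inr ?e" "V <+> E"
        "case_sum (\<lambda>v. top_of_set {0}) (\<lambda>e. top_of_set {0..1})"]
    by (simp add: pre_complex_def)
  then have "continuous_map (top_of_set {0..1}) ?X (\<lambda>t. glue (Inr ?e, t))"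
    using continuous_map_compose[OF _ quotient_imp_continuous_map[OF quotient_map_glue]]
    by (fastforce simp: o_def)
  moreover have "inj_on (\<lambda>t. glue (Inr ?e, t)) {0..1}"
    using e(2) by (auto simp: inj_on_def split: if_splits)
  ultimately have "arc_between ?X ((\<lambda>t. glue (Inr ?e, t)) ` {0..1}) (glue (Inr ?e, 0)) (glue (Inr ?e, 1))"
    using X by (intro arc_betweenI_interval) auto
  moreover have "(\<lambda>t. glue (Inr ?e, t)) ` {0..1} = edge_space ?e"
  proof
    have "tail_of ?e \<in> ?e" "head_of ?e \<in> ?e" using e(1) by blast+
    then show "(\<lambda>t. glue (Inr ?e, t)) ` {0..1} \<subseteq> edge_space ?e"
      by (auto simp: edge_space_def)
    show "edge_space ?e \<subseteq> (\<lambda>t. glue (Inr ?e, t)) ` {0..1}"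
    proof
      fix z assume "z \<in> edge_space ?e"
      then consider "z = (Inl (tail_of ?e), 0)" | "z = (Inl (head_of ?e), 0)"
        | t where "z = (Inr ?e, t)" "t \<in> {0<..<1}"
        unfolding edge_space_def using e(1) by blast
      then show "z \<in> (\<lambda>t. glue (Inr ?e, t)) ` {0..1}"
      proof cases
        case 1
        then show ?thesis by (intro image_eqI[of _ _ 0]) simp_all
      next
        case 2
        then show ?thesis by (intro image_eqI[of _ _ 1]) simp_all
      next
        case (3 t)
        then show ?thesis by (intro image_eqI[of _ _ t]) simp_all
      qed
    qed
  qed
  ultimately have arc: "arc_between ?X (edge_space ?e) (Inl (tail_of ?e), 0) (Inl (head_of ?e), 0)"
    by simp
  \<comment> \<open>The orientation of the edge was chosen arbitrarily, so the arc may have to be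
    reversed.\<close>
  have "u = tail_of ?e \<and> v = head_of ?e \<or> u = head_of ?e \<and> v = tail_of ?e"
    using e(1) by (metis doubleton_eq_iff)
  then show ?thesis using arc arc_between_sym[OF X arc] by metis
qed

fun path_space :: "'a list \<Rightarrow> 'a complex_point set" where
  "path_space [] = {}"
| "path_space [u] = {(Inl u, 0)}"
| "path_space (u # v # p) = edge_space {u, v} \<union> path_space (v # p)"

lemma path_space_Inl: "(Inl x, t) \<in> path_space p \<Longrightarrow> x \<in> set p \<and> t = 0"
  by (induction p rule: path_space.induct) (auto simp: edge_space_def)

lemma path_space_Inr: "(Inr e, t) \<in> path_space p \<Longrightarrow> e \<subseteq> set p"
  by (induction p rule: path_space.induct) (auto simp: edge_space_def)

lemma edge_space_subset_path_space: "edge_space {x, y} \<subseteq> path_space (p @ x # y # q)"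
proof (induction p)
  case (Cons a p)
  then show ?case by (cases p) auto
qed simp

lemma arc_between_path_space:
  assumes G: "simple_graph V E" and p: "graph_path V E p" "2 \<le> length p"
  shows "arc_between (one_complex V E) (path_space p) (Inl (hd p), 0) (Inl (last p), 0)"
  using p
proof (induction p rule: path_space.induct)
  case (3 u v p)
  have uv: "{u, v} \<in> E" and p: "graph_path V E (v # p)" "u \<notin> set (v # p)"
    using 3(2) by (auto simp: graph_path_def)
  have A: "arc_between (one_complex V E) (edge_space {u, v}) (Inl u, 0) (Inl v, 0)"
    by (rule arc_between_edge_space[OF G uv])
  show ?case
  proof (cases p)
    case Nil
    then show ?thesis using A arc_between_ends(2)[OF A] by (simp add: insert_absorb)
  next
    case (Cons w q)
    then have B: "arc_between (one_complex V E) (path_space (v # p)) (Inl v, 0) (Inl (last p), 0)"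
      using 3(1)[OF p(1)] by simp
    \<comment> \<open>Any other common point would be the vertex u or an inner point of the edge;
      either would put u on the rest of the path.\<close>
    have "edge_space {u, v} \<inter> path_space (v # p) \<subseteq> {(Inl v, 0)}"
    proof
      fix z assume "z \<in> edge_space {u, v} \<inter> path_space (v # p)"
      then show "z \<in> {(Inl v, 0)}"
        using p(2) by (cases z; cases "fst z") (auto simp: edge_space_def dest: path_space_Inl path_space_Inr)
    qed
    then have "edge_space {u, v} \<inter> path_space (v # p) = {(Inl v, 0)}"
      using arc_between_ends(2)[OF A] arc_between_ends(1)[OF B] by blast
    then show ?thesis
      using arc_between_join[OF Hausdorff_space_one_complex[OF G] A B] Cons by simp
  qed
qed auto

lemma circle_in_cycle:
  assumes G: "simple_graph V E" and p: "graph_cycle V E p"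
  shows "circle_in (one_complex V E) (path_space p \<union> edge_space {hd p, last p})"
proof -
  have path: "graph_path V E p" "3 \<le> length p" and e: "{hd p, last p} \<in> E"
    using p unfolding graph_cycle_def by (blast, blast, metis insert_commute)
  obtain u v w q where uvw: "p = u # v # w # q"
    using path(2) by (auto simp: numeral_3_eq_3 Suc_le_length_iff)
  have dist: "u \<notin> set (v # w # q)" "v \<notin> set (w # q)" using path(1) by (auto simp: uvw graph_path_def)
  have A: "arc_between (one_complex V E) (path_space p) (Inl (hd p), 0) (Inl (last p), 0)"
    using path by (intro arc_between_path_space[OF G]) auto
  have B: "arc_between (one_complex V E) (edge_space {hd p, last p}) (Inl (hd p), 0) (Inl (last p), 0)"
    by (rule arc_between_edge_space[OF G e])
  have last: "last p \<in> set (w # q)" "hd p = u" by (auto simp: uvw)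
  \<comment> \<open>The length bound of a cycle enters here: the closing edge is not the first edge,
    because the last vertex comes after v, and it is no later edge, because those do not contain
    u.\<close>
  have ne: "(Inr {hd p, last p}, t) \<notin> path_space p" for t
  proof
    assume "(Inr {hd p, last p}, t) \<in> path_space p"
    then have "(Inr {hd p, last p}, t) \<in> edge_space {u, v} \<or> (Inr {hd p, last p}, t) \<in> path_space (v # w # q)"
      by (simp add: uvw)
    then show False
    proof
      assume "(Inr {hd p, last p}, t) \<in> edge_space {u, v}"
      then have "{u, v} = {hd p, last p}" by (auto simp: edge_space_def)
      then have "v = last p" using dist(1) last(2) by (auto simp: doubleton_eq_iff)
      then show False using dist(2) last(1) by simp
    next
      assume "(Inr {hd p, last p}, t) \<in> path_space (v # w # q)"
      then show False using path_space_Inr dist(1) last(2) by fastforce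
    qed
  qed
  have "path_space p \<inter> edge_space {hd p, last p} = {(Inl (hd p), 0), (Inl (last p), 0)}"
  proof
    show "path_space p \<inter> edge_space {hd p, last p} \<subseteq> {(Inl (hd p), 0), (Inl (last p), 0)}"
      using ne by (auto simp: edge_space_def)
  qed (use arc_between_ends(1,2)[OF A] arc_between_ends(1,2)[OF B] in auto)
  then show ?thesis
    by (rule circle_in_two_arcs[OF Hausdorff_space_one_complex[OF G] A B])
qed


section \<open>Cycles in 2-connected graphs\<close>

lemma graph_path_rev: "graph_path V E (rev p) \<longleftrightarrow> graph_path V E p"
  by (simp add: graph_path_def insert_commute)

lemma graph_path_append_iff:
  assumes "p \<noteq> []" "q \<noteq> []"
  shows "graph_path V E (p @ q) \<longleftrightarrow>
    graph_path V E p \<and> graph_path V E q \<and> set p \<inter> set q = {} \<and> {last p, hd q} \<in> E"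
  using assms by (auto simp: graph_path_def successively_append_iff)

lemma graph_path_Cons_iff:
  "graph_path V E (x # p) \<longleftrightarrow>
    x \<in> V \<and> (p = [] \<or> graph_path V E p \<and> x \<notin> set p \<and> {x, hd p} \<in> E)"
  by (cases p) (auto simp: graph_path_def)

lemma graph_path_append1: "p \<noteq> [] \<Longrightarrow> graph_path V E (p @ q) \<Longrightarrow> graph_path V E p"
  and graph_path_append2: "q \<noteq> [] \<Longrightarrow> graph_path V E (p @ q) \<Longrightarrow> graph_path V E q"
  by (auto simp: graph_path_def successively_append_iff)

text \<open>Translates vertex deletion into avoidance, so that all paths live in one and the same
  graph and can be combined.\<close>

lemma graph_path_avoiding_iff:
  "graph_path (V - W) {e \<in> E. e \<inter> W = {}} p \<longleftrightarrow> graph_path V E p \<and> set p \<inter> W = {}"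
proof -
  have "successively (\<lambda>x y. {x, y} \<in> {e \<in> E. e \<inter> W = {}}) p \<longleftrightarrow> successively (\<lambda>x y. {x, y} \<in> E) p"
    if "set p \<inter> W = {}"
    using that by (intro successively_cong) auto
  then show ?thesis by (auto simp: graph_path_def)
qed

lemma split_list_two:
  assumes "x \<in> set p" "y \<in> set p" "x \<noteq> y"
  obtains r s t where "p = r @ x # s @ y # t \<or> p = r @ y # s @ x # t"
proof -
  obtain r q where p: "p = r @ x # q" using split_list[OF assms(1)] by blast
  then have "y \<in> set r \<or> y \<in> set q" using assms by auto
  then show thesis
  proof
    assume "y \<in> set r"
    then obtain r1 r2 where "r = r1 @ y # r2" using split_list by metis
    then show thesis using that[of r1 r2 q] p by auto
  next
    assume "y \<in> set q"
    then obtain q1 q2 where "q = q1 @ y # q2" using split_list by metis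
    then show thesis using that[of r q1 q2] p by auto
  qed
qed

lemma graph_path_subpath:
  assumes "graph_path V E p" "u \<in> set p" "w \<in> set p"
  obtains q where "graph_path V E q" "hd q = u" "last q = w"
proof (cases "u = w")
  case True
  then show thesis using assms that[of "[u]"] by (auto simp: graph_path_def)
next
  case False
  obtain r s t where "p = r @ u # s @ w # t \<or> p = r @ w # s @ u # t"
    using split_list_two[OF assms(2,3) False] .
  then show thesis
  proof
    assume "p = r @ u # s @ w # t"
    then have "graph_path V E ((u # s @ [w]) @ t)"
      using assms(1) graph_path_append2[of "u # s @ w # t" V E r] by simp
    then have "graph_path V E (u # s @ [w])" using graph_path_append1 by blast
    then show thesis using that[of "u # s @ [w]"] by simp
  next
    assume "p = r @ w # s @ u # t"
    then have "graph_path V E ((w # s @ [u]) @ t)"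
      using assms(1) graph_path_append2[of "w # s @ u # t" V E r] by simp
    then have "graph_path V E (w # s @ [u])" using graph_path_append1 by blast
    then have "graph_path V E (rev (w # s @ [u]))" unfolding graph_path_rev .
    then show thesis using that[of "rev (w # s @ [u])"] by simp
  qed
qed

lemma graph_path_extend:
  assumes p: "graph_path V E p" and w: "{last p, w} \<in> E" "w \<in> V"
  obtains q where "graph_path V E q" "hd q = hd p" "last q = w"
proof (cases "w \<in> set p")
  case True
  have "hd p \<in> set p" using p by (simp add: graph_path_def)
  then show thesis using graph_path_subpath[OF p _ True] that by metis
next
  case False
  have "p \<noteq> []" using p by (simp add: graph_path_def)
  moreover have "graph_path V E [w]" using w by (simp add: graph_path_def)
  ultimately have "graph_path V E (p @ [w])" using False w p by (subst graph_path_append_iff) auto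
  then show thesis using that \<open>p \<noteq> []\<close> by simp
qed

text \<open>The set of vertices reachable from u is left by no edge, so it has to be all of
  V.\<close>

lemma connected_graphI_cut:
  assumes "\<And>A. A \<subseteq> V \<Longrightarrow> A \<noteq> {} \<Longrightarrow> A \<noteq> V \<Longrightarrow> \<exists>x\<in>A. \<exists>y\<in>V - A. {x, y} \<in> E"
  shows "connected_graph V E"
  unfolding connected_graph_def
proof (intro ballI, rule ccontr)
  fix u v assume uv: "u \<in> V" "v \<in> V" and no: "\<nexists>p. graph_path V E p \<and> hd p = u \<and> last p = v"
  let ?A = "{x \<in> V. \<exists>p. graph_path V E p \<and> hd p = u \<and> last p = x}"
  have "u \<in> ?A" using uv by (auto simp: graph_path_def intro!: exI[of _ "[u]"])
  moreover have "v \<notin> ?A" using no by blast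
  ultimately obtain x y where xy: "x \<in> ?A" "y \<in> V - ?A" "{x, y} \<in> E"
    using assms[of ?A] uv by blast
  then obtain p where "graph_path V E p" "hd p = u" "last p = x" by blast
  then obtain q where "graph_path V E q" "hd q = u" "last q = y"
    using graph_path_extend[of V E p y] xy by auto
  then show False using xy by blast
qed

text \<open>Connectedness as an induction principle along edges; it later spreads the property of
  lying on a cycle through a fixed edge over the whole graph.\<close>

lemma connected_graph_closed:
  assumes G: "connected_graph V E" and u: "u \<in> V" "u \<in> A" and v: "v \<in> V"
    and closed: "\<And>x y. x \<in> A \<Longrightarrow> x \<in> V \<Longrightarrow> y \<in> V \<Longrightarrow> {x, y} \<in> E \<Longrightarrow> y \<in> A"
  shows "v \<in> A"
proof -
  obtain p where p: "graph_path V E p" "hd p = u" "last p = v"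
    using G u v unfolding connected_graph_def by blast
  have "last p \<in> A" using p(1) u(2)[folded p(2)]
  proof (induction p)
    case (Cons x p)
    then show ?case
      using closed[of x "hd p"] by (cases p) (auto simp: graph_path_Cons_iff)
  qed (simp add: graph_path_def)
  then show ?thesis using p by simp
qed

lemma connected_graph_edge:
  assumes G: "connected_graph V E" and uv: "u \<in> V" "v \<in> V" "u \<noteq> v"
  obtains w where "w \<in> V" "w \<noteq> u" "{u, w} \<in> E"
proof -
  note goal = that
  have "v \<in> {u}" if no: "\<not> thesis"
  proof (rule connected_graph_closed[OF G uv(1) _ uv(2)])
    show "y \<in> {u}" if "x \<in> {u}" "y \<in> V" "{x, y} \<in> E" for x y
      using goal[of y] no that by auto
  qed simp
  then show thesis using uv(3) by blast
qed

section \<open>Two edges of a 2-connected graph on a common cycle\<close>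

lemma k_connected_graph_2D:
  assumes "k_connected_graph 2 V E"
  shows "connected_graph V E"
    and "x \<in> V \<Longrightarrow> connected_graph (V - {x}) {e \<in> E. e \<inter> {x} = {}}"
  using assms[unfolded k_connected_graph_def, rule_format, of "{}"]
    assms[unfolded k_connected_graph_def, rule_format, of "{x}"] by simp_all

lemma k_connected_graph_2_path_avoiding:
  assumes "k_connected_graph 2 V E" "x \<in> V" "u \<in> V" "w \<in> V" "u \<noteq> x" "w \<noteq> x"
  obtains p where "graph_path V E p" "x \<notin> set p" "hd p = u" "last p = w"
proof -
  have "\<exists>p. graph_path V E p \<and> set p \<inter> {x} = {} \<and> hd p = u \<and> last p = w"
    using k_connected_graph_2D(2)[OF assms(1,2), unfolded connected_graph_def graph_path_avoiding_iff,
        rule_format, of u w] assms(3-) by simp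
  then show thesis using that by auto
qed

text \<open>A graph with an edge and no third vertex is the complete graph on two vertices. This is
  where its exclusion enters the construction of cycles.\<close>

lemma third_vertex:
  assumes G: "simple_graph V E" and K: "\<not> complete_graph 2 V E" and e: "{a, b} \<in> E"
  obtains c where "c \<in> V" "c \<noteq> a" "c \<noteq> b"
proof (rule ccontr)
  assume "\<not> thesis"
  then have "V \<subseteq> {a, b}" using that by blast
  moreover have ab: "{a, b} \<subseteq> V" "card {a, b} = 2" using G e by (auto simp: simple_graph_def)
  ultimately have V: "V = {a, b}" by blast
  have "f = {a, b}" if "f \<subseteq> V" "card f = 2" for f
    using that ab V card_subset_eq[of V f] by simp
  then have "E = {e. e \<subseteq> V \<and> card e = 2}"
    using G e ab V unfolding simple_graph_def by auto
  then have "complete_graph 2 V E" using ab V by (simp add: complete_graph_def)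
  with K show False ..
qed

text \<open>Q contains y and z itself, so r and t may be empty and the end vertices of the path
  still survive the detour; the closing edge of a cycle therefore stays in place.\<close>

lemma graph_path_replace:
  assumes p: "graph_path V E (r @ y # s @ z # t)"
    and Q: "graph_path V E Q" "hd Q = y" "last Q = z" "set Q \<inter> set (r @ y # s @ z # t) \<subseteq> {y, z}"
  shows "graph_path V E (r @ Q @ t)"
    "hd (r @ Q @ t) = hd (r @ y # s @ z # t)" "last (r @ Q @ t) = last (r @ y # s @ z # t)"
proof -
  have "Q \<noteq> []" using Q(1) by (simp add: graph_path_def)
  then show "hd (r @ Q @ t) = hd (r @ y # s @ z # t)" "last (r @ Q @ t) = last (r @ y # s @ z # t)"
    using Q by (auto simp: hd_append last_append)
  have "y \<notin> set r" "z \<notin> set r" "y \<notin> set t" "z \<notin> set t" "set r \<inter> set t = {}"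
    using p by (auto simp: graph_path_def)
  then have "set r \<inter> set Q = {}" "set Q \<inter> set t = {}" "set r \<inter> set t = {}" using Q(4) by auto
  moreover have "successively (\<lambda>x y. {x, y} \<in> E) (r @ [y])" "successively (\<lambda>x y. {x, y} \<in> E) (z # t)"
    "set r \<subseteq> V" "set t \<subseteq> V" "distinct r" "distinct t"
    using p by (auto simp: graph_path_def successively_append_iff successively_Cons)
  ultimately show "graph_path V E (r @ Q @ t)"
    using Q(1-3) \<open>Q \<noteq> []\<close> by (auto simp: graph_path_def successively_append_iff successively_Cons)
qed

text \<open>A cycle through the edge \<open>{a, b}\<close> is represented by the path of its other edges,
  i.e. by a \<open>graph_cycle\<close> with end vertices \<open>a\<close> and \<open>b\<close>.\<close>

lemma graph_cycle_add_edge: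
  assumes G: "simple_graph V E" and C: "k_connected_graph 2 V E" and ab: "{a, b} \<in> E"
    and p: "graph_cycle V E p" "hd p = a" "last p = b" and y: "y \<in> set p" "{y, z} \<in> E" "{y, z} \<noteq> {a, b}"
  obtains q r s where "graph_cycle V E q" "hd q = a" "last q = b" "q = r @ y # z # s \<or> q = r @ z # y # s"
proof -
  have yz: "y \<noteq> z" "y \<in> V" "z \<in> V"
    using simple_graph_edge[OF G y(2)] by (auto simp: doubleton_eq_iff)
  have path: "graph_path V E p" "3 \<le> length p" using p(1) by (auto simp: graph_cycle_def)
  \<comment> \<open>A detour that starts with the edge from y to z and meets the cycle only in y and
    x. If z is on the cycle, the edge alone will do. Otherwise a path from z to another vertex of
    the cycle, avoiding y by 2-connectedness, is stopped at its first vertex on the cycle.\<close>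
  obtain Q x where Q: "graph_path V E (y # z # Q)" "last (y # z # Q) = x" "x \<in> set p" "x \<noteq> y"
    "set (y # z # Q) \<inter> set p \<subseteq> {y, x}"
  proof (cases "z \<in> set p")
    case True
    then show thesis using that[of "[]" z] y yz by (auto simp: graph_path_def)
  next
    case False
    have "hd p \<in> set p" "last p \<in> set p" "hd p \<noteq> last p"
      using path simple_graph_edge(2)[OF G ab] p(2,3) simple_graph_edge(1)[OF G ab]
      by (auto simp: graph_path_def doubleton_eq_iff)
    then obtain w where w: "w \<in> set p" "w \<noteq> y" by metis
    then have "w \<in> V" using path by (auto simp: graph_path_def)
    then obtain R where R: "graph_path V E R" "y \<notin> set R" "hd R = z" "last R = w"
      using k_connected_graph_2_path_avoiding[OF C yz(2,3)] yz(1) w(2) by metis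
    have "w \<in> set R" using R(1,4) by (auto simp: graph_path_def)
    then obtain R1 x R2 where R12: "R = R1 @ x # R2" "x \<in> set p" "\<forall>v\<in>set R1. v \<notin> set p"
      using split_list_first_prop[of R "\<lambda>v. v \<in> set p"] w(1) by metis
    have "R1 \<noteq> []" using R12 R(3) False by auto
    then obtain Q where Q: "R1 = z # Q" using R(3) R12(1) by (cases R1) auto
    have "graph_path V E (R1 @ [x])"
      using R(1) graph_path_append1[of "R1 @ [x]" V E R2] by (simp add: R12(1))
    then have "graph_path V E (y # z # Q @ [x])"
      using yz y(2) R(2) R12(1) Q by (subst graph_path_Cons_iff) auto
    moreover have "x \<noteq> y" using R(2) R12(1) by auto
    ultimately show thesis using that[of "Q @ [x]" x] R12(2,3) Q by auto
  qed
  let ?Q = "y # z # Q"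
  \<comment> \<open>The segment of p between y and x is exchanged for the detour, traversed in
    whichever direction p meets them.\<close>
  obtain r s t where "p = r @ y # s @ x # t \<or> p = r @ x # s @ y # t"
    using split_list_two[OF y(1) Q(3)] Q(4) by metis
  then obtain q where q: "graph_path V E q" "hd q = a" "last q = b" "q = r @ ?Q @ t \<or> q = r @ rev ?Q @ t"
  proof
    assume pe: "p = r @ y # s @ x # t"
    show thesis
      using that[of "r @ ?Q @ t"] graph_path_replace[of V E r y s x t ?Q] path(1) p Q pe by simp
  next
    assume pe: "p = r @ x # s @ y # t"
    have "graph_path V E (rev ?Q)" "hd (rev ?Q) = x" "last (rev ?Q) = y"
      using Q(1,2) unfolding graph_path_rev hd_rev last_rev by simp_all
    moreover have "set (rev ?Q) \<inter> set (r @ x # s @ y # t) \<subseteq> {x, y}"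
      using Q(5) pe by auto
    ultimately show thesis
      using that[of "r @ rev ?Q @ t"] graph_path_replace[of V E r x s y t "rev ?Q"] path(1) p(2,3) pe
      by metis
  qed
  \<comment> \<open>A shorter q would consist of y and z alone, and since its ends are a and b the
    new edge would be \<open>{a, b}\<close>.\<close>
  have "3 \<le> length q"
  proof (rule ccontr)
    assume "\<not> 3 \<le> length q"
    moreover have "length q = length r + length Q + length t + 2" using q(4) by auto
    ultimately have "length r = 0" "length t = 0" "length Q = 0" by linarith+
    then show False using q y(3) by auto
  qed
  then have "graph_cycle V E q" using q ab by (auto simp: graph_cycle_def insert_commute)
  moreover have "\<exists>r s. q = r @ y # z # s \<or> q = r @ z # y # s"
  proof -
    have "q = r @ y # z # (Q @ t) \<or> q = (r @ rev Q) @ z # y # t" using q(4) by auto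
    then show ?thesis by blast
  qed
  ultimately show thesis using that q by blast
qed

text \<open>Since G - a is connected and contains a vertex besides b, there b has a neighbour n. A
  path from a to n in G - b, continued to b, is closed by the given edge.\<close>

lemma edge_on_cycle:
  assumes G: "simple_graph V E" and C: "k_connected_graph 2 V E" and K: "\<not> complete_graph 2 V E"
    and ab: "{a, b} \<in> E"
  obtains p where "graph_cycle V E p" "hd p = a" "last p = b"
proof -
  have abV: "a \<in> V" "b \<in> V" "a \<noteq> b"
    using simple_graph_edge[OF G ab] by (auto simp: doubleton_eq_iff)
  obtain c where c: "c \<in> V" "c \<noteq> a" "c \<noteq> b" using third_vertex[OF G K ab] .
  have "b \<in> V - {a}" "c \<in> V - {a}" "b \<noteq> c" using abV c by auto
  then obtain n where n: "n \<in> V" "n \<noteq> a" "n \<noteq> b" "{b, n} \<in> E"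
    using connected_graph_edge[OF k_connected_graph_2D(2)[OF C abV(1)]] by (metis (no_types, lifting) Diff_iff insertI1 mem_Collect_eq)
  obtain R where R: "graph_path V E R" "b \<notin> set R" "hd R = a" "last R = n"
    using k_connected_graph_2_path_avoiding[OF C abV(2) abV(1) n(1) abV(3) n(3)] .
  have "R \<noteq> []" using R(1) by (simp add: graph_path_def)
  then have "2 \<le> length R" using R(3,4) n(2) by (cases R; cases "tl R") auto
  moreover have "graph_path V E (R @ [b])"
    using R \<open>R \<noteq> []\<close> n abV(2) by (subst graph_path_append_iff) (auto simp: graph_path_def insert_commute)
  ultimately show thesis
    using that[of "R @ [b]"] R(3) ab \<open>R \<noteq> []\<close> by (simp add: graph_cycle_def insert_commute)
qed

lemma two_edges_on_cycle:
  assumes G: "simple_graph V E" and C: "k_connected_graph 2 V E" and K: "\<not> complete_graph 2 V E"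
    and ab: "{a, b} \<in> E" and xy: "{x, y} \<in> E"
  obtains p where "graph_cycle V E p" "hd p = a" "last p = b"
    "{x, y} = {a, b} \<or> (\<exists>r s. p = r @ x # y # s \<or> p = r @ y # x # s)"
proof -
  \<comment> \<open>The vertices on a cycle through the edge \<open>{a, b}\<close>. Adding edges
    shows that this set is closed under adjacency, so it contains x; one more addition puts the edge
    \<open>{x, y}\<close> itself on a cycle.\<close>
  let ?A = "{v. \<exists>p. graph_cycle V E p \<and> hd p = a \<and> last p = b \<and> v \<in> set p}"
  have abV: "a \<in> V" using simple_graph_edge(5)[OF G ab] by auto
  have xV: "x \<in> V" using simple_graph_edge(5)[OF G xy] by auto
  obtain p0 where p0: "graph_cycle V E p0" "hd p0 = a" "last p0 = b"
    using edge_on_cycle[OF G C K ab] .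
  then have in_p0: "a \<in> set p0" "b \<in> set p0" by (auto simp: graph_cycle_def graph_path_def)
  have "x \<in> ?A"
  proof (rule connected_graph_closed[OF k_connected_graph_2D(1)[OF C] abV _ xV])
    show "a \<in> ?A" using p0 in_p0 by blast
    fix u v assume u: "u \<in> ?A" and uv: "{u, v} \<in> E"
    then obtain p where p: "graph_cycle V E p" "hd p = a" "last p = b" "u \<in> set p" by blast
    show "v \<in> ?A"
    \<comment> \<open>The edge \<open>{a, b}\<close> cannot be added to the path representing the
      cycle, but both its ends lie on every such cycle, in particular on \<open>p0\<close>.\<close>
    proof (cases "{u, v} = {a, b}")
      case True
      then have "v \<in> set p0" using in_p0 by (auto simp: doubleton_eq_iff)
      then show ?thesis using p0 by blast
    next
      case False
      then obtain q r s where "graph_cycle V E q" "hd q = a" "last q = b" "q = r @ u # v # s \<or> q = r @ v # u # s"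
        using graph_cycle_add_edge[OF G C ab p uv] by metis
      then show ?thesis by auto
    qed
  qed
  then obtain p where p: "graph_cycle V E p" "hd p = a" "last p = b" "x \<in> set p" by blast
  show thesis
  proof (cases "{x, y} = {a, b}")
    case True
    then show thesis using that p by blast
  next
    case False
    then show thesis using graph_cycle_add_edge[OF G C ab p xy] that by metis
  qed
qed

lemma k_connected_graph_2_imp_cyclically_connected:
  assumes G: "simple_graph V E" and C: "k_connected_graph 2 V E" and K: "\<not> complete_graph 2 V E"
  shows "cyclically_connected V E"
  unfolding cyclically_connected_def
proof (intro ballI impI)
  fix u v assume uv: "u \<in> V" "v \<in> V" "u \<noteq> v"
  obtain u' where u': "{u, u'} \<in> E"
    using connected_graph_edge[OF k_connected_graph_2D(1)[OF C] uv] by metis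
  obtain v' where v': "{v, v'} \<in> E"
    using connected_graph_edge[OF k_connected_graph_2D(1)[OF C] uv(2,1)] uv(3) by metis
  obtain p where p: "graph_cycle V E p" "hd p = u" "last p = u'"
    "{v, v'} = {u, u'} \<or> (\<exists>r s. p = r @ v # v' # s \<or> p = r @ v' # v # s)"
    using two_edges_on_cycle[OF G C K u' v'] .
  then have "p \<noteq> []" by (auto simp: graph_cycle_def)
  then have "u \<in> set p" "u' \<in> set p" using p(2,3) by auto
  then have "u \<in> set p" "v \<in> set p" using p(4) by (auto simp: doubleton_eq_iff)
  then show "\<exists>p. graph_cycle V E p \<and> u \<in> set p \<and> v \<in> set p" using p(1) by blast
qed

section \<open>From cycles back to 2-connectedness\<close>

lemma graph_cycle_remove_vertex:
  assumes p: "graph_cycle V E p" and uw: "u \<in> set p - {x}" "w \<in> set p - {x}"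
  obtains q where "graph_path V E q" "x \<notin> set q" "u \<in> set q" "w \<in> set q"
proof (cases "x \<in> set p")
  case False
  then show thesis using that[of p] p uw by (auto simp: graph_cycle_def)
next
  case True
  then obtain r s where rs: "p = r @ x # s" using split_list by metis
  have path: "graph_path V E p" "{last p, hd p} \<in> E" using p by (auto simp: graph_cycle_def)
  \<comment> \<open>The cycle is cut open at x: the part after x is followed by the part before x,
    linked by the closing edge.\<close>
  have "graph_path V E (s @ r)"
  proof -
    have "r \<noteq> [] \<or> s \<noteq> []" using uw rs by auto
    then show ?thesis
      using path graph_path_append1[of r V E "x # s"] graph_path_append2[of s V E "r @ [x]"]
      unfolding rs by (cases "r = []"; cases "s = []") (auto simp: graph_path_append_iff graph_path_def successively_append_iff)
  qed
  moreover have "x \<notin> set (s @ r)" using path(1) by (auto simp: rs graph_path_def)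
  ultimately show thesis using that[of "s @ r"] uw by (auto simp: rs)
qed

lemma cyclically_connected_imp_k_connected_graph_2:
  assumes "cyclically_connected V E"
  shows "k_connected_graph 2 V E"
  unfolding k_connected_graph_def
proof (intro allI impI, elim conjE)
  fix W assume W: "W \<subseteq> V" "finite W" "card W < 2"
  have "W = {} \<or> (\<exists>x. W = {x})"
    using W card_1_singletonE[of W] by (cases "card W = 0") auto
  then obtain x where x: "W \<subseteq> {x}" by blast
  show "connected_graph (V - W) {e \<in> E. e \<inter> W = {}}"
    unfolding connected_graph_def
  proof (intro ballI)
    fix u w assume uw: "u \<in> V - W" "w \<in> V - W"
    have "\<exists>q. graph_path (V - W) {e \<in> E. e \<inter> W = {}} q \<and> u \<in> set q \<and> w \<in> set q"
    proof (cases "u = w")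
      case True
      then show ?thesis using uw by (intro exI[of _ "[u]"]) (auto simp: graph_path_def)
    next
      case False
      then obtain p where p: "graph_cycle V E p" "u \<in> set p" "w \<in> set p"
        using assms uw unfolding cyclically_connected_def by blast
      show ?thesis
      proof (cases "W = {}")
        case True
        then show ?thesis using p by (auto simp: graph_cycle_def)
      next
        case False
        then have "W = {x}" using x by blast
        then have "u \<in> set p - {x}" "w \<in> set p - {x}" using p uw by auto
        then obtain q where "graph_path V E q" "x \<notin> set q" "u \<in> set q" "w \<in> set q"
          by (rule graph_cycle_remove_vertex[OF p(1)])
        then show ?thesis
          unfolding graph_path_avoiding_iff \<open>W = {x}\<close> by (intro exI[of _ q]) simp
      qed
    qed
    then obtain q where "graph_path (V - W) {e \<in> E. e \<inter> W = {}} q" "u \<in> set q" "w \<in> set q"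
      by blast
    then show "\<exists>p. graph_path (V - W) {e \<in> E. e \<inter> W = {}} p \<and> hd p = u \<and> last p = w"
      by (rule graph_path_subpath) blast
  qed
qed

lemma cyclically_connected_imp_not_complete_graph_2:
  assumes "cyclically_connected V E" "u \<in> V" "w \<in> V" "u \<noteq> w"
  shows "\<not> complete_graph 2 V E"
proof
  assume K: "complete_graph 2 V E"
  obtain p where "graph_cycle V E p" using assms unfolding cyclically_connected_def by blast
  then have "3 \<le> card (set p)" "set p \<subseteq> V"
    by (auto simp: graph_cycle_def graph_path_def distinct_card)
  then show False using K card_mono[of V "set p"] by (auto simp: complete_graph_def)
qed


section \<open>The equivalence\<close>

lemma joined_avoiding_imp_k_connected_graph_2:
  assumes G: "simple_graph V E"
    and joined: "\<And>u w v. u \<in> topspace (one_complex V E) \<Longrightarrow> w \<in> topspace (one_complex V E) \<Longrightarrow>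
      u \<noteq> w \<Longrightarrow> u \<noteq> v \<Longrightarrow> w \<noteq> v \<Longrightarrow> joined_avoiding (one_complex V E) v u w"
  shows "k_connected_graph 2 V E" and "\<not> complete_graph 2 V E"
proof -
  let ?X = "one_complex V E"
  note top = topspace_one_complex[OF G]
  have inner: "\<exists>e\<in>E. \<exists>t. z = (Inr e, t) \<and> 0 < t \<and> t < 1" if "z \<in> topspace ?X" "\<nexists>v. v \<in> V \<and> z = (Inl v, 0)" for z
    using that by (auto simp: top)
  show "k_connected_graph 2 V E"
    unfolding k_connected_graph_def
  proof (intro allI impI, elim conjE)
    fix W assume W: "W \<subseteq> V" "finite W" "card W < 2"
    have "W = {} \<or> (\<exists>x. W = {x})"
      using W card_1_singletonE[of W] by (cases "card W = 0") auto
    then obtain x where x: "W \<subseteq> {x}" by blast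
    show "connected_graph (V - W) {e \<in> E. e \<inter> W = {}}"
    proof (rule connected_graphI_cut, rule ccontr)
      fix A assume A: "A \<subseteq> V - W" "A \<noteq> {}" "A \<noteq> V - W"
        and no: "\<not> (\<exists>a\<in>A. \<exists>b\<in>V - W - A. {a, b} \<in> {e \<in> E. e \<inter> W = {}})"
      have no_edge: "{a, b} \<notin> E" if "a \<in> A" "b \<in> V - W - A" for a b
      proof
        assume "{a, b} \<in> E"
        moreover have "{a, b} \<inter> W = {}" using that A(1) by auto
        ultimately show False using no that by blast
      qed
      obtain u w where uw: "u \<in> A" "w \<in> V - W - A" using A by blast
      \<comment> \<open>The linear extension of g can vanish only at a vertex of W: no edge runs
        from A to the other side, so the end values of an edge never have opposite signs, and they
        are not both 0 because W has at most one element.\<close>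
      define g :: "'a \<Rightarrow> real" where "g = (\<lambda>v. if v \<in> W then 0 else if v \<in> A then 1 else -1)"
      \<comment> \<open>For \<open>W = {}\<close> nothing has to be avoided: \<open>(Inl x, 1)\<close> is not a point of the complex.\<close>
      define p :: "'a complex_point" where "p = (Inl x, if x \<in> W then 0 else 1)"
      have "joined_avoiding ?X p (Inl u, 0) (Inl w, 0)"
        using uw A(1) by (intro joined) (auto simp: top p_def)
      moreover have "0 < g u" "g w < 0" using uw A(1) by (auto simp: g_def)
      ultimately obtain z where z: "z \<in> topspace ?X" "z \<noteq> p" "linear_extension g z = 0"
        using linear_extension_zero[of V E p u w g] by blast
      show False
      proof (cases "\<exists>v. v \<in> V \<and> z = (Inl v, 0)")
        case True
        then show False using z x by (auto simp: linear_extension_def g_def p_def split: if_splits)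
      next
        case False
        then obtain e t where e: "e \<in> E" "z = (Inr e, t)" "0 < t" "t < 1" using inner[OF z(1)] by blast
        let ?a = "tail_of e" and ?b = "head_of e"
        note ab = simple_graph_edge[OF G e(1)]
        have zero: "(1 - t) * g ?a + t * g ?b = 0" using z(3) e(2) by (simp add: linear_extension_def)
        have "\<not> (?a \<in> W \<and> ?b \<in> W)" using ab(2) x by blast
        moreover have "{?a, ?b} \<in> E" "{?b, ?a} \<in> E" using ab(1) e(1) by (metis insert_commute)+
        then have "\<not> (?a \<in> A \<and> ?b \<in> V - W - A)" "\<not> (?b \<in> A \<and> ?a \<in> V - W - A)"
          using no_edge by blast+
        ultimately show False
          using zero e(3,4) ab(3,4) A(1) by (auto simp: g_def split: if_splits)
      qed
    qed
  qed
  show "\<not> complete_graph 2 V E"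
  proof
    assume K: "complete_graph 2 V E"
    then obtain u w where V: "V = {u, w}" "u \<noteq> w" by (auto simp: complete_graph_def card_2_iff)
    have E: "E = {V}"
    proof -
      have "e = V" if "e \<subseteq> V" "card e = 2" for e
        using that K card_subset_eq[of V e] by (auto simp: complete_graph_def)
      then show ?thesis using K by (auto simp: complete_graph_def)
    qed
    \<comment> \<open>For the complete graph on two vertices the midpoint of the edge separates:
      with end values 1 and -1, the linear extension vanishes only at t = 1/2.\<close>
    define g :: "'a \<Rightarrow> real" where "g = (\<lambda>v. if v = u then 1 else -1)"
    have "joined_avoiding ?X (Inr V, 1/2) (Inl u, 0) (Inl w, 0)"
    proof (rule joined)
      show "(Inl u, 0) \<in> topspace ?X" "(Inl w, 0) \<in> topspace ?X"
        using V(1) unfolding top by blast+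
    qed (use V(2) in simp_all)
    moreover have "0 < g u" "g w < 0" using V(2) by (auto simp: g_def)
    ultimately obtain z where z: "z \<in> topspace ?X" "z \<noteq> (Inr V, 1/2)" "linear_extension g z = 0"
      using linear_extension_zero[of V E "(Inr V, 1/2)" u w g] by blast
    show False
    proof (cases "\<exists>v. v \<in> V \<and> z = (Inl v, 0)")
      case True
      then show False using z(3) by (auto simp: linear_extension_def g_def split: if_splits)
    next
      case False
      then obtain t where t: "z = (Inr V, t)" using inner[OF z(1)] E by blast
      then have zero: "(1 - t) * g (tail_of V) + t * g (head_of V) = 0"
        using z(3) by (simp add: linear_extension_def)
      have "V \<in> E" using E by simp
      then have "tail_of V = u \<and> head_of V = w \<or> tail_of V = w \<and> head_of V = u"
        using simple_graph_edge(1)[OF G, of V] V by (metis doubleton_eq_iff)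
      then have "t = 1/2" using zero V(2) by (auto simp: g_def)
      then show False using z(2) t by simp
    qed
  qed
qed

lemma k_connected_graph_2_imp_n_cc_2:
  assumes G: "simple_graph V E" and C: "k_connected_graph 2 V E" and K: "\<not> complete_graph 2 V E"
    and V2: "v \<in> V" "w \<in> V" "v \<noteq> w"
  shows "n_cc 2 (one_complex V E)"
proof -
  let ?X = "one_complex V E"
  note top = topspace_one_complex[OF G]
  \<comment> \<open>For a vertex this needs a neighbour, which exists as G is connected and has a
    second vertex. Two points of |G| are thereby reduced to two edges, which may coincide.\<close>
  have on_edge: "\<exists>a b. {a, b} \<in> E \<and> z \<in> edge_space {a, b}" if z: "z \<in> topspace ?X" for z
  proof -
    consider u where "z = (Inl u, 0)" "u \<in> V" | e t where "z = (Inr e, t)" "e \<in> E" "0 < t" "t < 1"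
      using z by (auto simp: top)
    then show ?thesis
    proof cases
      case 1
      obtain u' where "{u, u'} \<in> E"
        using connected_graph_edge[OF k_connected_graph_2D(1)[OF C] 1(2)] V2 by metis
      then show ?thesis using 1 by (intro exI[of _ u] exI[of _ u']) (simp add: edge_space_def)
    next
      case 2
      have "z \<in> edge_space e" using 2 by (simp add: edge_space_def)
      then show ?thesis using 2(2) simple_graph_edge(1)[OF G 2(2)] by metis
    qed
  qed
  have pair: "\<exists>C. circle_in ?X C \<and> y \<in> C \<and> z \<in> C" if yz: "y \<in> topspace ?X" "z \<in> topspace ?X" for y z
  proof -
    obtain a b where ab: "{a, b} \<in> E" "y \<in> edge_space {a, b}" using on_edge[OF yz(1)] by blast
    obtain c d where cd: "{c, d} \<in> E" "z \<in> edge_space {c, d}" using on_edge[OF yz(2)] by blast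
    obtain p where p: "graph_cycle V E p" "hd p = a" "last p = b"
      "{c, d} = {a, b} \<or> (\<exists>r s. p = r @ c # d # s \<or> p = r @ d # c # s)"
      using two_edges_on_cycle[OF G C K ab(1) cd(1)] .
    have "edge_space {c, d} \<subseteq> path_space p \<union> edge_space {a, b}"
      using p(4)
    proof (elim disjE exE)
      fix r s assume "p = r @ c # d # s"
      then show ?thesis using edge_space_subset_path_space[of c d r s] by auto
    next
      fix r s assume "p = r @ d # c # s"
      then show ?thesis using edge_space_subset_path_space[of d c r s] by (auto simp: insert_commute[of d])
    qed simp
    then show ?thesis
      using circle_in_cycle[OF G p(1)] ab(2) cd(2) p(2,3)
      by (intro exI[of _ "path_space p \<union> edge_space {a, b}"]) auto
  qed
  show ?thesis
    unfolding n_cc_def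
  proof (intro allI impI, elim conjE)
    fix S assume S: "S \<subseteq> topspace ?X" "finite S" "card S \<le> 2"
    have v: "(Inl v, 0) \<in> topspace ?X" using V2 by (simp add: top)
    consider "S = {}" | x where "S = {x}" | x y where "S = {x, y}"
    proof -
      have "card S = 0 \<or> card S = 1 \<or> card S = 2" using S(3) by linarith
      then show thesis using that S(2) by (auto simp: card_1_singleton_iff card_2_iff)
    qed
    \<comment> \<open>Smaller sets are covered by repeating a point, the empty one by the vertex v
      as a default.\<close>
    then obtain x y where "x \<in> topspace ?X" "y \<in> topspace ?X" "S \<subseteq> {x, y}"
      using v S(1) by cases auto
    then show "\<exists>C. circle_in ?X C \<and> S \<subseteq> C" using pair by blast
  qed
qed

theorem theorem3p1p1:
  fixes V :: "'a set" and E :: "'a set set"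
  assumes "simple_graph V E"
    and "\<exists>v\<in>V. \<exists>w\<in>V. v \<noteq> w"
  shows "(n_sac 3 (one_complex V E) \<longleftrightarrow> cyclically_connected V E) \<and>
    (cyclically_connected V E \<longleftrightarrow> three_points_on_circle_or_theta (one_complex V E)) \<and>
    (three_points_on_circle_or_theta (one_complex V E) \<longleftrightarrow>
       \<not> complete_graph 2 V E \<and> k_connected_graph 2 V E) \<and>
    (\<not> complete_graph 2 V E \<and> k_connected_graph 2 V E \<longleftrightarrow> n_cc 2 (one_complex V E))"
proof -
  let ?X = "one_complex V E" and ?C = "\<not> complete_graph 2 V E \<and> k_connected_graph 2 V E"
  note G = assms(1)
  have H: "Hausdorff_space ?X" by (rule Hausdorff_space_one_complex[OF G])
  obtain v w where vw: "v \<in> V" "w \<in> V" "v \<noteq> w" using assms(2) by blast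
  have sac: "n_sac 3 ?X \<Longrightarrow> ?C"
    using joined_avoiding_imp_k_connected_graph_2[OF G n_sac_3_joined_avoiding] by blast
  have three: "three_points_on_circle_or_theta ?X \<Longrightarrow> ?C"
    using joined_avoiding_imp_k_connected_graph_2[OF G three_points_joined_avoiding[OF H]] by blast
  have cc: "n_cc 2 ?X \<Longrightarrow> ?C"
    using joined_avoiding_imp_k_connected_graph_2[OF G n_cc_2_joined_avoiding] by blast
  have cyc: "cyclically_connected V E \<longleftrightarrow> ?C"
    using k_connected_graph_2_imp_cyclically_connected[OF G]
      cyclically_connected_imp_k_connected_graph_2
      cyclically_connected_imp_not_complete_graph_2[OF _ vw] by blast
  have "?C \<Longrightarrow> n_cc 2 ?X" using k_connected_graph_2_imp_n_cc_2[OF G _ _ vw] by blast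
  then show ?thesis
    using sac three cc cyc n_cc_2_imp_n_sac_3[OF H] n_cc_2_imp_three_points[OF H] by blast
qed

end
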